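(* For $i=1,2$ let $G_{i}$ be an $r_{i}$-regular graph of order $p_{i}$ with adjacency spectrum $\{r_{i},\lambda_{i_{2}},\ldots,\lambda_{i_{p_{i}}}\}$. Then the distance Laplacian spectrum of the subdivision-edge join $G_{1}\oplus G_{2}$ consists of: (1) for $j=2,\ldots,p_1$, writing $\lambda=\lambda_{1_j}$: $\lambda+\frac{7p_{1}}{2}+\frac{5p_{2}}{2}+\frac{5p_{1}r_{1}}{4}+\frac{3p_{2}r_{2}}{4}-2r_{1}-2\pm\frac{1}{2}\sqrt{\Delta_{1,j}}$, where $\Delta_{1,j}=4\lambda^2+2\lambda p_{1}r_{1}+4\lambda p_{1}+2\lambda p_{2}r_{2}+4\lambda p_{2}-16\lambda r_{1}+32\lambda+\frac{1}{4}p_{1}^2r_{1}^2+p_{1}^2r_{1}+p_{1}^2+\frac{1}{2}p_{1}p_{2}r_{1}r_{2}+p_{1}p_{2}r_{1}+p_{1}p_{2}r_{2}+2p_{1}p_{2}-4p_{1}r_{1}^2-4p_{1}r_{1}+8p_{1}+\frac{1}{4}p_{2}^2r_{2}^2+p_{2}^2r_{2}+p_{2}^2-4p_{2}r_{1}r_{2}-8p_{2}r_{1}+4p_{2}r_{2}+8p_{2}+16r_{1}^2-16r_{1}+16$; (2) for $j=2,\ldots,p_2$, writing $\lambda=\lambda_{2_j}$: $\lambda+\frac{5p_{1}}{2}+\frac{7p_{2}}{2}+\frac{3p_{1}r_{1}}{4}+\frac{5p_{2}r_{2}}{4}-2r_{2}-2\pm\frac{1}{2}\sqrt{\Delta_{2,j}}$,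 where $\Delta_{2,j}=4\lambda^2+2\lambda p_{1}r_{1}+4\lambda p_{1}+2\lambda p_{2}r_{2}+4\lambda p_{2}-16\lambda r_{2}+32\lambda+\frac{1}{4}p_{1}^2r_{1}^2+p_{1}^2r_{1}+p_{1}^2+\frac{1}{2}p_{1}p_{2}r_{1}r_{2}+p_{1}p_{2}r_{1}+p_{1}p_{2}r_{2}+2p_{1}p_{2}-4p_{1}r_{1}r_{2}+4p_{1}r_{1}-8p_{1}r_{2}+8p_{1}+\frac{1}{4}p_{2}^2r_{2}^2+p_{2}^2r_{2}+p_{2}^2-4p_{2}r_{2}^{2}-4p_{2}r_{2}+8p_{2}+16r_{2}^2-16r_{2}+16$; (3) $3p_{1}+p_{1}r_{1}+2p_{2}+\frac{1}{2}p_{2}r_{2}-4$ with multiplicity $\frac{1}{2}p_{1}r_{1}-p_{1}$; (4) $2p_{1}+\frac{1}{2}p_{1}r_{1}+3p_{2}+p_{2}r_{2}-4$ with multiplicity $\frac{1}{2}p_{2}r_{2}-p_{2}$; (5) the four eigenvalues of the matrix $$\begin{bmatrix} \frac{3}{2}p_{1}r_{1}+3p_{2}+p_{2}r_{2}-2r_{1} & 2r_{1}-\frac{3}{2}p_{1}r_{1} & -3p_{2} & -p_{2}r_{2}\\ 4-3p_{1} & 3p_{1}+2p_{2}+\frac{1}{2}p_{2}r_{2}-4 & -2p_{2} & -\frac{1}{2}p_{2}r_{2}\\ -3p_{1} & -p_{1}r_{1} & 3p_{1}+p_{1}r_{1}+\frac{3}{2}p_{2}r_{2}-2r_{2} & 2r_{2}-\frac{3}{2}p_{2}r_{2}\\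 -2p_{1} & -\frac{1}{2}p_{1}r_{1} & 4-3p_{2} & 2p_{1}+\frac{1}{2}p_{1}r_{1}+3p_{2}-4\end{bmatrix}.$$
   Context: The subdivision graph $S(G)$ is obtained from $G$ by inserting a new vertex into every edge; $I(G)$ denotes the set of these new vertices. The subdivision-edge join $G_1\oplus G_2$ is obtained from $S(G_1)$ and $S(G_2)$ by joining each vertex of $I(G_1)$ with every vertex of $I(G_2)$. For a connected graph, $\mathcal{D}$ is its distance matrix, $Tr$ the diagonal matrix of vertex transmissions ($Tr(u)=\sum_v d(u,v)$), and the distance Laplacian matrix is $\mathcal{L}=Tr-\mathcal{D}$. *)

theory Defs
  imports
    "HOL-Computational_Algebra.Computational_Algebra"
    "Jordan_Normal_Form.Char_Poly"
    "Graph_Theory.Graph_Theory"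
begin

section \<open>Graphs\<close>

text \<open>
  A finite simple graph is a \<^locale>\<open>pair_graph\<close>: a finite, loop-free digraph whose arc
  relation is symmetric, so that an edge \<open>uv\<close> is represented by the two arcs \<open>(u, v)\<close> and \<open>(v, u)\<close>.
\<close>

definition regular_graph :: "nat \<Rightarrow> 'a pair_pre_digraph \<Rightarrow> bool" where
  "regular_graph r G \<longleftrightarrow> pair_graph G \<and> (\<forall>v \<in> pverts G. out_degree (with_proj G) v = r)"

definition undirected_edges :: "'a pair_pre_digraph \<Rightarrow> 'a set set" where
  "undirected_edges G = (\<lambda>(u, v). {u, v}) ` parcs G"

text \<open>
  The vertices of \<open>S(G)\<close> are \<open>Inl v\<close> for the vertices \<open>v\<close> of \<open>G\<close> and \<open>Inr e\<close> for the new vertex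
  inserted into the edge \<open>e\<close>.
\<close>

definition inserted_vertices :: "'a pair_pre_digraph \<Rightarrow> ('a + 'a set) set" where
  "inserted_vertices G = Inr ` undirected_edges G"

definition subdivision_graph :: "'a pair_pre_digraph \<Rightarrow> ('a + 'a set) pair_pre_digraph" where
  "subdivision_graph G =
     \<lparr> pverts = Inl ` pverts G \<union> inserted_vertices G,
       parcs = {(Inl u, Inr e) | u e. e \<in> undirected_edges G \<and> u \<in> e}
             \<union> {(Inr e, Inl u) | u e. e \<in> undirected_edges G \<and> u \<in> e} \<rparr>"

definition subdivision_edge_join ::
  "'a pair_pre_digraph \<Rightarrow> 'b pair_pre_digraph \<Rightarrow>
     (('a + 'a set) + ('b + 'b set)) pair_pre_digraph" where
  "subdivision_edge_join G1 G2 =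
     \<lparr> pverts = Inl ` pverts (subdivision_graph G1) \<union> Inr ` pverts (subdivision_graph G2),
       parcs = map_prod Inl Inl ` parcs (subdivision_graph G1)
             \<union> map_prod Inr Inr ` parcs (subdivision_graph G2)
             \<union> Inl ` inserted_vertices G1 \<times> Inr ` inserted_vertices G2
             \<union> Inr ` inserted_vertices G2 \<times> Inl ` inserted_vertices G1 \<rparr>"

lemma pair_graph_subdivision_edge_join:
  assumes "pair_graph G1" "pair_graph G2"
  shows "pair_graph (subdivision_edge_join G1 G2)"
proof -
  interpret G1: pair_graph G1 by fact
  interpret G2: pair_graph G2 by fact
  have sub1: "u \<in> pverts G1" if "e \<in> undirected_edges G1" "u \<in> e" for u e
    using that by (force simp: undirected_edges_def dest: G1.arc_fst_in_verts G1.arc_snd_in_verts)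
  have sub2: "u \<in> pverts G2" if "e \<in> undirected_edges G2" "u \<in> e" for u e
    using that by (force simp: undirected_edges_def dest: G2.arc_fst_in_verts G2.arc_snd_in_verts)
  have fin: "finite (undirected_edges G1)" "finite (undirected_edges G2)"
    by (simp_all add: undirected_edges_def G1.pair_finite_arcs G2.pair_finite_arcs)
  let ?J = "subdivision_edge_join G1 G2"
  have mp: "(x, y) \<in> map_prod f f ` R \<longleftrightarrow> (\<exists>x' y'. x = f x' \<and> y = f y' \<and> (x', y') \<in> R)"
    for x y f and R :: "'c rel"
    by force
  have ends: "fst a \<in> pverts ?J" "snd a \<in> pverts ?J" "fst a \<noteq> snd a" "(snd a, fst a) \<in> parcs ?J"
    if "a \<in> parcs ?J" for a
    using that sub1 sub2
    by (cases a; force simp: subdivision_edge_join_def subdivision_graph_def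
        inserted_vertices_def mp)+
  have finV: "finite (pverts ?J)"
    using fin by (simp add: G1.pair_finite_verts G2.pair_finite_verts subdivision_edge_join_def subdivision_graph_def inserted_vertices_def)
  have "parcs ?J \<subseteq> pverts ?J \<times> pverts ?J"
    using ends(1,2) by (metis mem_Times_iff subsetI)
  with finV have finA: "finite (parcs ?J)" by (meson finite_SigmaI finite_subset)
  show ?thesis
    by unfold_locales
      (use ends finV finA in \<open>auto simp: symmetric_def arcs_ends_conv sym_def\<close>)
qed

section \<open>Distances and matrices\<close>

text \<open>
  The library's shortest-path length with unit weights.  It is an extended real, infinite between
  different components (where the conversion below would yield 0), so this is the graph distance
  for connected graphs only.
\<close>

definition graph_dist :: "'a pair_pre_digraph \<Rightarrow> 'a \<Rightarrow> 'a \<Rightarrow> real" where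
  "graph_dist G u v = real_of_ereal (wf_digraph.\<mu> (with_proj G) (\<lambda>_. 1) u v)"

definition transmission :: "'a pair_pre_digraph \<Rightarrow> 'a \<Rightarrow> real" where
  "transmission G u = (\<Sum>v \<in> pverts G. graph_dist G u v)"

text \<open>
  Matrices are indexed by positions in a list \<open>vs\<close> enumerating the vertices without repetition.
\<close>

definition adjacency_matrix :: "'a pair_pre_digraph \<Rightarrow> 'a list \<Rightarrow> real mat" where
  "adjacency_matrix G vs =
     mat (length vs) (length vs) (\<lambda>(i, j). if (vs ! i, vs ! j) \<in> parcs G then 1 else 0)"

definition distance_matrix :: "'a pair_pre_digraph \<Rightarrow> 'a list \<Rightarrow> real mat" where
  "distance_matrix G vs =
     mat (length vs) (length vs) (\<lambda>(i, j). graph_dist G (vs ! i) (vs ! j))"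

definition transmission_matrix :: "'a pair_pre_digraph \<Rightarrow> 'a list \<Rightarrow> real mat" where
  "transmission_matrix G vs =
     mat (length vs) (length vs) (\<lambda>(i, j). if i = j then transmission G (vs ! i) else 0)"

definition distance_laplacian_matrix :: "'a pair_pre_digraph \<Rightarrow> 'a list \<Rightarrow> real mat" where
  "distance_laplacian_matrix G vs = transmission_matrix G vs - distance_matrix G vs"

text \<open>All complex eigenvalues, with algebraic multiplicity.\<close>

definition eigenvalues_mset :: "real mat \<Rightarrow> complex multiset" where
  "eigenvalues_mset A = proots (char_poly (map_mat complex_of_real A))"

section \<open>The explicit eigenvalues\<close>

text \<open>
  In the names below, the suffix 1 or 2 refers to the graph whose adjacency eigenvalue \<open>l\<close> is used.
  The two eigenvalues attached to \<open>l\<close> are the centre plus and minus half the square root of the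
  discriminant.
\<close>

definition centre1 :: "real \<Rightarrow> real \<Rightarrow> real \<Rightarrow> real \<Rightarrow> real \<Rightarrow> real" where
  "centre1 p1 r1 p2 r2 l =
     l + 7 * p1 / 2 + 5 * p2 / 2 + 5 * p1 * r1 / 4 + 3 * p2 * r2 / 4 - 2 * r1 - 2"

definition discriminant1 :: "real \<Rightarrow> real \<Rightarrow> real \<Rightarrow> real \<Rightarrow> real \<Rightarrow> real" where
  "discriminant1 p1 r1 p2 r2 l =
     4 * l^2 + 2 * l * p1 * r1 + 4 * l * p1 + 2 * l * p2 * r2 + 4 * l * p2 - 16 * l * r1 + 32 * l
     + 1/4 * p1^2 * r1^2 + p1^2 * r1 + p1^2 + 1/2 * p1 * p2 * r1 * r2 + p1 * p2 * r1 + p1 * p2 * r2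
     + 2 * p1 * p2 - 4 * p1 * r1^2 - 4 * p1 * r1 + 8 * p1
     + 1/4 * p2^2 * r2^2 + p2^2 * r2 + p2^2 - 4 * p2 * r1 * r2 - 8 * p2 * r1 + 4 * p2 * r2 + 8 * p2
     + 16 * r1^2 - 16 * r1 + 16"

definition centre2 :: "real \<Rightarrow> real \<Rightarrow> real \<Rightarrow> real \<Rightarrow> real \<Rightarrow> real" where
  "centre2 p1 r1 p2 r2 l =
     l + 5 * p1 / 2 + 7 * p2 / 2 + 3 * p1 * r1 / 4 + 5 * p2 * r2 / 4 - 2 * r2 - 2"

definition discriminant2 :: "real \<Rightarrow> real \<Rightarrow> real \<Rightarrow> real \<Rightarrow> real \<Rightarrow> real" where
  "discriminant2 p1 r1 p2 r2 l =
     4 * l^2 + 2 * l * p1 * r1 + 4 * l * p1 + 2 * l * p2 * r2 + 4 * l * p2 - 16 * l * r2 + 32 * l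
     + 1/4 * p1^2 * r1^2 + p1^2 * r1 + p1^2 + 1/2 * p1 * p2 * r1 * r2 + p1 * p2 * r1 + p1 * p2 * r2
     + 2 * p1 * p2 - 4 * p1 * r1 * r2 + 4 * p1 * r1 - 8 * p1 * r2 + 8 * p1
     + 1/4 * p2^2 * r2^2 + p2^2 * r2 + p2^2 - 4 * p2 * r2^2 - 4 * p2 * r2 + 8 * p2
     + 16 * r2^2 - 16 * r2 + 16"

definition plus_minus_pair :: "real \<Rightarrow> real \<Rightarrow> complex multiset" where
  "plus_minus_pair c d =
     {# complex_of_real (c + 1/2 * sqrt d), complex_of_real (c - 1/2 * sqrt d) #}"

definition quotient_matrix :: "real \<Rightarrow> real \<Rightarrow> real \<Rightarrow> real \<Rightarrow> real mat" where
  "quotient_matrix p1 r1 p2 r2 = mat_of_rows_list 4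
     [[3/2 * p1 * r1 + 3 * p2 + p2 * r2 - 2 * r1, 2 * r1 - 3/2 * p1 * r1, - 3 * p2, - p2 * r2],
      [4 - 3 * p1, 3 * p1 + 2 * p2 + 1/2 * p2 * r2 - 4, - 2 * p2, - 1/2 * p2 * r2],
      [- 3 * p1, - p1 * r1, 3 * p1 + p1 * r1 + 3/2 * p2 * r2 - 2 * r2, 2 * r2 - 3/2 * p2 * r2],
      [- 2 * p1, - 1/2 * p1 * r1, 4 - 3 * p2, 2 * p1 + 1/2 * p1 * r1 + 3 * p2 - 4]]"

text \<open>
  The multiplicity \<open>p r / 2 - p\<close> of an eigenvalue is negative for \<open>r = 1\<close>.  Multiplicities are
  therefore added up as real numbers: a negative one cancels copies of the same number that occur
  elsewhere in the list.  For \<open>r \<ge> 2\<close> this is the usual union of multisets.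
\<close>

definition multiplicity_at :: "real \<Rightarrow> real \<Rightarrow> complex \<Rightarrow> real" where
  "multiplicity_at a m x = (if x = complex_of_real a then m else 0)"

end

theory Submission
  imports Defs
begin

text \<open>
  Distances in the join take, up to corrections coming from equality, adjacency and incidence within
  one of the two graphs, a constant value on each pair of the four vertex classes.  Hence
  \<open>z I - L = X + U C U\<^sup>T\<close> where \<open>X\<close> is block diagonal with one block for each graph,
  \<open>U\<close> holds the indicator vectors of the classes and \<open>C\<close> is a \<open>4 \<times> 4\<close> matrix.  By regularity
  \<open>X U = U Y\<close> for a \<open>4 \<times> 4\<close> matrix \<open>Y\<close>, so
  \<open>det (X + U C U\<^sup>T) det Y = det X det (Y + C U\<^sup>T U)\<close>, and the last factor is the characteristic
  polynomial of the quotient matrix.  A Schur complement and \<open>B B\<^sup>T = A + r I\<close> for the incidence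
  matrix \<open>B\<close> express \<open>det X\<close> through the adjacency eigenvalues as a product of quadratic
  factors, and those of the eigenvalues \<open>r\<^sub>1\<close> and \<open>r\<^sub>2\<close> cancel against \<open>det Y\<close>.
\<close>

no_notation fps_nth (infixl \<open>$\<close> 75)

section \<open>Determinants of matrices indexed by lists\<close>

text \<open>Indexing by lists of labels turns concatenation of lists into block structure, products
  into sums over finite sets, and a change of enumeration into a permutation.\<close>

definition kernel_mat :: "('a \<Rightarrow> 'b \<Rightarrow> 'c) \<Rightarrow> 'a list \<Rightarrow> 'b list \<Rightarrow> 'c mat" where
  "kernel_mat f xs ys = mat (length xs) (length ys) (\<lambda>(i, j). f (xs ! i) (ys ! j))"

lemma kernel_mat_carrier [simp]: "kernel_mat f xs ys \<in> carrier_mat (length xs) (length ys)"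
  by (simp add: kernel_mat_def)

lemma dim_kernel_mat [simp]:
  "dim_row (kernel_mat f xs ys) = length xs" "dim_col (kernel_mat f xs ys) = length ys"
  by (simp_all add: kernel_mat_def)

lemma kernel_mat_cong:
  assumes "\<And>x y. x \<in> set xs \<Longrightarrow> y \<in> set ys \<Longrightarrow> f x y = g x y"
  shows "kernel_mat f xs ys = kernel_mat g xs ys"
  using assms by (auto simp: kernel_mat_def)

lemma kernel_mat_map:
  "kernel_mat f (map g xs) (map h ys) = kernel_mat (\<lambda>x y. f (g x) (h y)) xs ys"
  by (auto simp: kernel_mat_def)

lemma kernel_mat_mult:
  fixes f :: "'a \<Rightarrow> 'b \<Rightarrow> 'd :: semiring_0"
  assumes "distinct ys"
  shows "kernel_mat f xs ys * kernel_mat g ys zs = kernel_mat (\<lambda>x z. \<Sum>y\<in>set ys. f x y * g y z) xs zs"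
proof (rule eq_matI)
  fix i j assume "i < dim_row (kernel_mat (\<lambda>x z. \<Sum>y\<in>set ys. f x y * g y z) xs zs)"
    "j < dim_col (kernel_mat (\<lambda>x z. \<Sum>y\<in>set ys. f x y * g y z) xs zs)"
  then show "(kernel_mat f xs ys * kernel_mat g ys zs) $$ (i, j) =
      kernel_mat (\<lambda>x z. \<Sum>y\<in>set ys. f x y * g y z) xs zs $$ (i, j)"
    using assms
    by (simp add: kernel_mat_def scalar_prod_def sum.distinct_set_conv_list
        sum_list_sum_nth flip: sum_list_distinct_conv_sum_set)
qed simp_all

lemma kernel_mat_append:
  "kernel_mat f (xs @ xs') (ys @ ys') =
     four_block_mat (kernel_mat f xs ys) (kernel_mat f xs ys') (kernel_mat f xs' ys) (kernel_mat f xs' ys')"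
  by (rule eq_matI) (auto simp: kernel_mat_def nth_append)

text \<open>Rows and columns undergo the same permutation, whose sign enters twice. This allows an
  arbitrary enumeration of the vertices to be replaced by one sorted into blocks.\<close>

lemma det_kernel_mat_cong_set:
  fixes f :: "'a \<Rightarrow> 'a \<Rightarrow> 'c :: comm_ring_1"
  assumes "distinct xs" "distinct ys" "set xs = set ys"
  shows "det (kernel_mat f xs xs) = det (kernel_mat f ys ys)"
proof -
  have "mset xs = mset ys"
    using assms by (simp add: set_eq_iff_mset_eq_distinct)
  then obtain p where p: "p permutes {..<length ys}" "permute_list p ys = xs"
    by (rule mset_eq_permutation)
  let ?n = "length ys"
  let ?A = "kernel_mat f ys ys"
  have len: "length xs = ?n" using p(2) by auto
  have p': "p permutes {0..<?n}" using p(1) by (simp add: atLeast0LessThan)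
  have lt: "p i < ?n" if "i < ?n" for i
    using permutes_in_image[OF p(1)] that by simp
  have nth: "xs ! i = ys ! p i" if "i < ?n" for i
    using p that by (metis permute_list_nth)
  let ?B = "mat ?n ?n (\<lambda>(i, j). ?A $$ (p i, j))"
  \<comment> \<open>Permuting the rows of the transpose permutes the columns of
    \<open>?B\<close>.\<close>
  let ?C = "mat ?n ?n (\<lambda>(i, j). transpose_mat ?B $$ (p i, j))"
  have "kernel_mat f xs xs = transpose_mat ?C"
    by (rule eq_matI) (auto simp: kernel_mat_def len nth lt)
  also have "det \<dots> = det ?C"
    by (rule det_transpose[of _ ?n]) simp
  also have "\<dots> = signof p * det (transpose_mat ?B)"
    by (rule det_permute_rows[OF _ p']) simp
  also have "det (transpose_mat ?B) = det ?B"
    by (rule det_transpose[of _ ?n]) simp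
  also have "det ?B = signof p * det ?A"
    by (rule det_permute_rows[OF _ p']) simp
  also have "signof p * (signof p * det ?A) = det ?A"
    by (cases "evenperm p") (auto simp: sign_def)
  finally show ?thesis .
qed

lemma poly_char_poly_kernel_mat:
  fixes f :: "'a \<Rightarrow> 'a \<Rightarrow> 'c :: field"
  assumes "distinct xs"
  shows "poly (char_poly (kernel_mat f xs xs)) z =
     det (kernel_mat (\<lambda>x y. z * of_bool (x = y) - f x y) xs xs)"
proof -
  have "poly (char_poly (kernel_mat f xs xs)) z = det (- char_matrix (kernel_mat f xs xs) z)"
    by (rule char_poly_matrix) (rule kernel_mat_carrier)
  also have "- char_matrix (kernel_mat f xs xs) z =
      kernel_mat (\<lambda>x y. z * of_bool (x = y) - f x y) xs xs"
    by (rule eq_matI) (auto simp: kernel_mat_def char_matrix_def nth_eq_iff_index_eq assms)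
  finally show ?thesis .
qed

text \<open>Multiplying the block matrix \<open>?M\<close> by the unipotent \<open>?R\<close> from
  the left and from the right gives two block triangular matrices; the intertwining relation clears
  the upper right block in the second. No inverse occurs, so singular \<open>X\<close> and
  \<open>Y\<close> are covered.\<close>

lemma det_add_mult_intertwined:
  fixes X :: "'a :: idom mat"
  assumes X: "X \<in> carrier_mat n n" and U: "U \<in> carrier_mat n k"
    and W: "W \<in> carrier_mat k n" and Y: "Y \<in> carrier_mat k k"
    and XU: "X * U = U * Y"
  shows "det (X - U * W) * det Y = det X * det (Y - W * U)"
proof -
  let ?M = "four_block_mat X (U * Y) W Y"
  let ?R = "four_block_mat (1\<^sub>m n) (- U) (0\<^sub>m k n) (1\<^sub>m k)"
  have M: "?M \<in> carrier_mat (n + k) (n + k)" and R: "?R \<in> carrier_mat (n + k) (n + k)"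
    using assms by auto
  have detR: "det ?R = 1"
    by (subst det_four_block_mat_lower_left_zero[of _ n _ k]) (use U in auto)
  have "?R * ?M = four_block_mat (X - U * W) (0\<^sub>m n k) W Y"
    by (subst mult_four_block_mat[of _ n n _ k _ k _ _ n _ k])
      (use assms in \<open>auto intro!: arg_cong2[where f = "\<lambda>a b. four_block_mat a b W Y"]
         simp: minus_add_uminus_mat[of _ n n] add_uminus_minus_mat[of _ n k]\<close>)
  then have "det ?M = det (four_block_mat (X - U * W) (0\<^sub>m n k) W Y)"
    using det_mult[OF R M] detR by simp
  also have "\<dots> = det (X - U * W) * det Y"
    by (rule det_four_block_mat_upper_right_zero[of _ n _ k]) (use assms in auto)
  finally have 1: "det ?M = det (X - U * W) * det Y" .
  have "?M * ?R = four_block_mat X (0\<^sub>m n k) W (Y - W * U)"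
    by (subst mult_four_block_mat[of _ n n _ k _ k _ _ n _ k])
      (use assms in \<open>auto intro!: arg_cong2[where f = "\<lambda>a b. four_block_mat X a W b"]\<close>)
  then have "det ?M = det (four_block_mat X (0\<^sub>m n k) W (Y - W * U))"
    using det_mult[OF M R] detR by simp
  also have "\<dots> = det X * det (Y - W * U)"
    by (rule det_four_block_mat_upper_right_zero[of _ n _ k]) (use assms in auto)
  finally have "det ?M = det X * det (Y - W * U)" .
  with 1 show ?thesis by simp
qed

text \<open>Right multiplication by \<open>?R\<close> eliminates the lower left block and leaves the
  Schur complement scaled by \<open>y\<close>. Powers of \<open>y\<close> on both sides replace a
  division, so \<open>y = 0\<close> is allowed.\<close>

lemma det_four_block_scalar:
  fixes P :: "'a :: idom mat"
  assumes P: "P \<in> carrier_mat n n" and B: "B \<in> carrier_mat n m" and C: "C \<in> carrier_mat m n"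
  shows "y ^ n * det (four_block_mat P B C (y \<cdot>\<^sub>m 1\<^sub>m m)) = y ^ m * det (y \<cdot>\<^sub>m P - B * C)"
proof -
  let ?M = "four_block_mat P B C (y \<cdot>\<^sub>m 1\<^sub>m m)"
  let ?R = "four_block_mat (y \<cdot>\<^sub>m 1\<^sub>m n) (0\<^sub>m n m) (- C) (1\<^sub>m m)"
  have M: "?M \<in> carrier_mat (n + m) (n + m)" and R: "?R \<in> carrier_mat (n + m) (n + m)"
    using assms by auto
  have detR: "det ?R = y ^ n"
    by (subst det_four_block_mat_upper_right_zero[of _ n _ m]) (use C in auto)
  have "?M * ?R = four_block_mat (y \<cdot>\<^sub>m P - B * C) B (0\<^sub>m m n) (y \<cdot>\<^sub>m 1\<^sub>m m)"
    by (subst mult_four_block_mat[of _ n n _ m _ m _ _ n _ m])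
      (use assms in \<open>auto intro!: arg_cong2[where f = "\<lambda>a b. four_block_mat a B b (y \<cdot>\<^sub>m 1\<^sub>m m)"]\<close>)
  then have "y ^ n * det ?M = det (four_block_mat (y \<cdot>\<^sub>m P - B * C) B (0\<^sub>m m n) (y \<cdot>\<^sub>m 1\<^sub>m m))"
    using det_mult[OF M R] detR by (simp add: mult.commute)
  also have "\<dots> = det (y \<cdot>\<^sub>m P - B * C) * det (y \<cdot>\<^sub>m 1\<^sub>m m)"
    by (rule det_four_block_mat_lower_left_zero[of _ n _ m]) (use assms in auto)
  finally show ?thesis
    by (simp add: mult.commute)
qed

section \<open>Distances in the subdivision-edge join\<close>

text \<open>The function \<open>d\<close> certifies breadth-first levels: \<open>step\<close> bounds
  the length of every walk from below, and following \<open>pred\<close> backwards builds a walk of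
  length \<open>d v\<close>.\<close>

lemma graph_dist_eqI:
  fixes d :: "'a \<Rightarrow> nat"
  assumes "pair_wf_digraph G" and u: "u \<in> pverts G" and v: "v \<in> pverts G" and d0: "d u = 0"
    and step: "\<And>x y. (x, y) \<in> parcs G \<Longrightarrow> d y \<le> d x + 1"
    and pred: "\<And>y. y \<in> pverts G \<Longrightarrow> y \<noteq> u \<Longrightarrow> \<exists>x. (x, y) \<in> parcs G \<and> d y = d x + 1"
  shows "graph_dist G u v = real (d v)"
proof -
  interpret pair_wf_digraph G by fact
  have cost: "awalk_cost (\<lambda>_. 1) p = real (length p)" for p :: "('a \<times> 'a) list"
    by (induction p) auto
  have lower: "d y \<le> d x + length p" if "awalk x p y" for x y p
    using that
  proof (induction p arbitrary: x)
    case Nil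
    then show ?case by (simp add: awalk_Nil_iff)
  next
    case (Cons a p)
    obtain b c where a: "a = (b, c)" by fastforce
    from Cons.prems have "x = b" "(b, c) \<in> parcs G" "awalk c p y"
      by (simp_all add: awalk_Cons_iff a)
    with Cons.IH[of c] step[of b c] show ?case by simp
  qed
  have upper: "\<exists>p. awalk u p y \<and> length p = n" if "y \<in> pverts G" "d y = n" for y n
    using that
  proof (induction n arbitrary: y)
    case 0
    \<comment> \<open>A vertex at level 0 other than \<open>u\<close> would have a predecessor and
      so a positive level.\<close>
    then have "y = u" using pred by fastforce
    then show ?case using u by (intro exI[of _ "[]"]) (simp add: awalk_Nil_iff)
  next
    case (Suc n)
    then have "y \<noteq> u" using d0 by auto
    with Suc.prems pred obtain x where x: "(x, y) \<in> parcs G" "d x = n" by fastforce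
    then obtain p where p: "awalk u p x" "length p = n"
      using Suc.IH[of x] arc_fst_in_verts[of "(x, y)"] by auto
    have "awalk u (p @ [(x, y)]) y"
      using p(1) arc_implies_awalk[of "(x, y)"] x(1) by (intro awalk_appendI) auto
    then show ?case using p(2) by (intro exI[of _ "p @ [(x, y)]"]) simp
  qed
  obtain p where p: "awalk u p v" "length p = d v"
    using upper[OF v refl] by blast
  have "\<mu> (\<lambda>_. 1) u v = ereal (real (d v))"
  proof (rule antisym)
    show "\<mu> (\<lambda>_. 1) u v \<le> ereal (real (d v))"
      using min_cost_le_walk_cost[OF p(1), of "\<lambda>_. 1"] p(2) by (simp add: cost)
    show "ereal (real (d v)) \<le> \<mu> (\<lambda>_. 1) u v"
      unfolding \<mu>_def using lower d0 by (intro INF_greatest) (force simp: cost)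
  qed
  then show ?thesis by (simp add: graph_dist_def)
qed

text \<open>Distances inside the join, not inside \<open>S(G)\<close>: any two new vertices of one
  graph have a common neighbour among the new vertices of the other, which caps the remaining
  distances at 3 and 4.\<close>

fun subdivision_dist :: "'a pair_pre_digraph \<Rightarrow> 'a + 'a set \<Rightarrow> 'a + 'a set \<Rightarrow> nat" where
  "subdivision_dist G (Inl u) (Inl v) = (if u = v then 0 else if (u, v) \<in> parcs G then 2 else 4)"
| "subdivision_dist G (Inl u) (Inr e) = (if u \<in> e then 1 else 3)"
| "subdivision_dist G (Inr e) (Inl u) = (if u \<in> e then 1 else 3)"
| "subdivision_dist G (Inr e) (Inr f) = (if e = f then 0 else 2)"

text \<open>Distance to the nearest new vertex when no vertex is isolated. A walk across must reach
  a new vertex on each side, and the summand 1 in \<open>join_dist\<close> is the arc between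
  them.\<close>

fun inserted_dist :: "'a + 'b \<Rightarrow> nat" where
  "inserted_dist (Inl _) = 1"
| "inserted_dist (Inr _) = 0"

fun join_dist :: "'a pair_pre_digraph \<Rightarrow> 'b pair_pre_digraph \<Rightarrow>
    ('a + 'a set) + ('b + 'b set) \<Rightarrow> ('a + 'a set) + ('b + 'b set) \<Rightarrow> nat" where
  "join_dist G1 G2 (Inl x) (Inl y) = subdivision_dist G1 x y"
| "join_dist G1 G2 (Inr x) (Inr y) = subdivision_dist G2 x y"
| "join_dist G1 G2 (Inl x) (Inr y) = inserted_dist x + inserted_dist y + 1"
| "join_dist G1 G2 (Inr x) (Inl y) = inserted_dist x + inserted_dist y + 1"

lemma pverts_subdivision_edge_join:
  "pverts (subdivision_edge_join G1 G2) =
     (pverts G1 <+> undirected_edges G1) <+> (pverts G2 <+> undirected_edges G2)"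
  by (auto simp: subdivision_edge_join_def subdivision_graph_def inserted_vertices_def Plus_def)

lemma parcs_subdivision_edge_join [simp]:
  "(Inl (Inl u), Inl (Inl v)) \<notin> parcs (subdivision_edge_join G1 G2)"
  "(Inl (Inr e), Inl (Inr f)) \<notin> parcs (subdivision_edge_join G1 G2)"
  "(Inl (Inl u), Inl (Inr e)) \<in> parcs (subdivision_edge_join G1 G2) \<longleftrightarrow> e \<in> undirected_edges G1 \<and> u \<in> e"
  "(Inl (Inr e), Inl (Inl u)) \<in> parcs (subdivision_edge_join G1 G2) \<longleftrightarrow> e \<in> undirected_edges G1 \<and> u \<in> e"
  "(Inr (Inl w), Inr (Inl z)) \<notin> parcs (subdivision_edge_join G1 G2)"
  "(Inr (Inr g), Inr (Inr h)) \<notin> parcs (subdivision_edge_join G1 G2)"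
  "(Inr (Inl w), Inr (Inr g)) \<in> parcs (subdivision_edge_join G1 G2) \<longleftrightarrow> g \<in> undirected_edges G2 \<and> w \<in> g"
  "(Inr (Inr g), Inr (Inl w)) \<in> parcs (subdivision_edge_join G1 G2) \<longleftrightarrow> g \<in> undirected_edges G2 \<and> w \<in> g"
  "(Inl (Inl u), Inr y) \<notin> parcs (subdivision_edge_join G1 G2)"
  "(Inl x, Inr (Inl w)) \<notin> parcs (subdivision_edge_join G1 G2)"
  "(Inr (Inl w), Inl x) \<notin> parcs (subdivision_edge_join G1 G2)"
  "(Inr y, Inl (Inl u)) \<notin> parcs (subdivision_edge_join G1 G2)"
  "(Inl (Inr e), Inr (Inr g)) \<in> parcs (subdivision_edge_join G1 G2) \<longleftrightarrow>
     e \<in> undirected_edges G1 \<and> g \<in> undirected_edges G2"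
  "(Inr (Inr g), Inl (Inr e)) \<in> parcs (subdivision_edge_join G1 G2) \<longleftrightarrow>
     e \<in> undirected_edges G1 \<and> g \<in> undirected_edges G2"
  by (auto simp: subdivision_edge_join_def subdivision_graph_def inserted_vertices_def)

context pair_graph
begin

lemma arc_sym: "(u, v) \<in> parcs G \<longleftrightarrow> (v, u) \<in> parcs G"
  using sym_arcs by (auto simp: symmetric_def sym_def)

lemma finite_undirected_edges: "finite (undirected_edges G)"
  by (simp add: undirected_edges_def pair_finite_arcs)

lemma undirected_edgeE:
  assumes "e \<in> undirected_edges G"
  obtains u v where "e = {u, v}" "u \<noteq> v" "u \<in> pverts G" "v \<in> pverts G" "(u, v) \<in> parcs G"
  using assms by (auto simp: undirected_edges_def dest: in_arcsD1 in_arcsD2 no_loops')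

lemma insert_in_undirected_edges: "{u, v} \<in> undirected_edges G \<longleftrightarrow> (u, v) \<in> parcs G"
  using arc_sym by (force simp: undirected_edges_def doubleton_eq_iff)

lemma undirected_edge_eq:
  assumes "e \<in> undirected_edges G" "u \<in> e" "v \<in> e" "u \<noteq> v"
  shows "e = {u, v}"
  using assms by (auto elim!: undirected_edgeE)

lemma arc_of_undirected_edge:
  assumes "e \<in> undirected_edges G" "u \<in> e" "v \<in> e" "u \<noteq> v"
  shows "(u, v) \<in> parcs G"
  using undirected_edge_eq[OF assms] assms(1) by (simp add: insert_in_undirected_edges)

end

lemma join_vertex_cases [case_names 1 2 3 4]:
  fixes x :: "('a + 'c) + ('b + 'd)"
  obtains u where "x = Inl (Inl u)" | e where "x = Inl (Inr e)"
    | w where "x = Inr (Inl w)" | g where "x = Inr (Inr g)"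
  by (metis sum.exhaust)

text \<open>Both conditions of \<open>graph_dist_eqI\<close> are checked by cases over the four
  kinds of vertices. The incidence assumptions exclude isolated vertices; together with
  non-emptiness they give each side an edge through which the other side can make detours.\<close>

lemma graph_dist_subdivision_edge_join:
  assumes G1: "pair_graph G1" and G2: "pair_graph G2"
    and inc1: "\<And>u. u \<in> pverts G1 \<Longrightarrow> \<exists>e\<in>undirected_edges G1. u \<in> e" and ne1: "pverts G1 \<noteq> {}"
    and inc2: "\<And>u. u \<in> pverts G2 \<Longrightarrow> \<exists>e\<in>undirected_edges G2. u \<in> e" and ne2: "pverts G2 \<noteq> {}"
    and x: "x \<in> pverts (subdivision_edge_join G1 G2)" and y: "y \<in> pverts (subdivision_edge_join G1 G2)"
  shows "graph_dist (subdivision_edge_join G1 G2) x y = real (join_dist G1 G2 x y)"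
proof -
  interpret G1: pair_graph G1 by fact
  interpret G2: pair_graph G2 by fact
  interpret J: pair_graph "subdivision_edge_join G1 G2"
    by (rule pair_graph_subdivision_edge_join) fact+
  obtain e01 e02 where edge0: "e01 \<in> undirected_edges G1" "e02 \<in> undirected_edges G2"
    using inc1 ne1 inc2 ne2 by blast
  have verts:
    "Inl (Inl u) \<in> pverts (subdivision_edge_join G1 G2) \<longleftrightarrow> u \<in> pverts G1"
    "Inl (Inr e) \<in> pverts (subdivision_edge_join G1 G2) \<longleftrightarrow> e \<in> undirected_edges G1"
    "Inr (Inl w) \<in> pverts (subdivision_edge_join G1 G2) \<longleftrightarrow> w \<in> pverts G2"
    "Inr (Inr g) \<in> pverts (subdivision_edge_join G1 G2) \<longleftrightarrow> g \<in> undirected_edges G2"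
    for u e w g
    by (auto simp: pverts_subdivision_edge_join)
  show ?thesis
  proof (rule graph_dist_eqI[OF _ x y])
    show "pair_wf_digraph (subdivision_edge_join G1 G2)" ..
    show "join_dist G1 G2 x x = 0"
      by (cases x rule: join_vertex_cases) simp_all
  next
    \<comment> \<open>Rules out the value 4 for two ends of one edge, which would exceed the
      distance 1 to that edge by more than one.\<close>
    have eq1: "u = v" if "e \<in> undirected_edges G1" "u \<in> e" "v \<in> e" "(u, v) \<notin> parcs G1" for e u v
      using G1.arc_of_undirected_edge that by blast
    have eq2: "u = v" if "e \<in> undirected_edges G2" "u \<in> e" "v \<in> e" "(u, v) \<notin> parcs G2" for e u v
      using G2.arc_of_undirected_edge that by blast
    fix a b assume ab: "(a, b) \<in> parcs (subdivision_edge_join G1 G2)"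
    then show "join_dist G1 G2 x b \<le> join_dist G1 G2 x a + 1"
      by (cases x rule: join_vertex_cases; cases a rule: join_vertex_cases; cases b rule: join_vertex_cases)
        (auto intro: eq1 eq2)
  next
    fix b assume b: "b \<in> pverts (subdivision_edge_join G1 G2)" "b \<noteq> x"
    \<comment> \<open>The witness is always the last vertex before \<open>b\<close> on a shortest
      walk from \<open>x\<close>.\<close>
    show "\<exists>a. (a, b) \<in> parcs (subdivision_edge_join G1 G2) \<and> join_dist G1 G2 x b = join_dist G1 G2 x a + 1"
    proof (cases x rule: join_vertex_cases)
      case (1 u)
      then have u: "u \<in> pverts G1" using x verts by simp
      then obtain eu where eu: "eu \<in> undirected_edges G1" "u \<in> eu" using inc1 by blast
      show ?thesis
      proof (cases b rule: join_vertex_cases)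
        case (1 v)
        with b \<open>x = Inl (Inl u)\<close> have v: "v \<in> pverts G1" "v \<noteq> u" using verts by auto
        show ?thesis
        proof (cases "(u, v) \<in> parcs G1")
          case True
          then show ?thesis
            using v \<open>x = Inl (Inl u)\<close> \<open>b = Inl (Inl v)\<close>
            by (intro exI[of _ "Inl (Inr {u, v})"]) (simp add: G1.insert_in_undirected_edges)
        next
          case False
          obtain e where e: "e \<in> undirected_edges G1" "v \<in> e" using inc1 v(1) by blast
          \<comment> \<open>Any edge at \<open>v\<close> avoids the non-neighbour \<open>u\<close>,
            so it is at distance 3 from \<open>u\<close>, and \<open>v\<close> is at distance
            4.\<close>
          then have "u \<notin> e" using False v(2) G1.arc_of_undirected_edge by blast
          with e False show ?thesis
            using v \<open>x = Inl (Inl u)\<close> \<open>b = Inl (Inl v)\<close> by (intro exI[of _ "Inl (Inr e)"]) simp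
        qed
      next
        case (2 e)
        then have "e \<in> undirected_edges G1" using b verts by simp
        \<comment> \<open>An edge that does not contain \<open>u\<close> is reached through
          \<open>e02\<close> in the other graph, at distance 2 from \<open>u\<close>.\<close>
        then show ?thesis
          using \<open>x = Inl (Inl u)\<close> \<open>b = Inl (Inr e)\<close> edge0
          by (intro exI[of _ "if u \<in> e then x else Inr (Inr e02)"]) simp
      next
        case (3 w)
        then have "w \<in> pverts G2" using b verts by simp
        then obtain g where "g \<in> undirected_edges G2" "w \<in> g" using inc2 by blast
        then show ?thesis
          using \<open>x = Inl (Inl u)\<close> \<open>b = Inr (Inl w)\<close> by (intro exI[of _ "Inr (Inr g)"]) simp
      next
        case (4 g)
        then have "g \<in> undirected_edges G2" using b verts by simp
        then show ?thesis
          using eu \<open>x = Inl (Inl u)\<close> \<open>b = Inr (Inr g)\<close> by (intro exI[of _ "Inl (Inr eu)"]) simp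
      qed
    next
      case (2 e)
      then have e: "e \<in> undirected_edges G1" using x verts by simp
      show ?thesis
      proof (cases b rule: join_vertex_cases)
        case (1 v)
        then have "v \<in> pverts G1" using b verts by simp
        then obtain f where "f \<in> undirected_edges G1" "v \<in> f" using inc1 by blast
        then show ?thesis
          using e \<open>x = Inl (Inr e)\<close> \<open>b = Inl (Inl v)\<close>
          by (intro exI[of _ "Inl (Inr (if v \<in> e then e else f))"]) auto
      next
        case (2 f)
        with b \<open>x = Inl (Inr e)\<close> have "f \<in> undirected_edges G1" "f \<noteq> e" using verts by auto
        then show ?thesis
          using \<open>x = Inl (Inr e)\<close> \<open>b = Inl (Inr f)\<close> edge0
          by (intro exI[of _ "Inr (Inr e02)"]) simp
      next
        case (3 w)
        then have "w \<in> pverts G2" using b verts by simp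
        then obtain g where "g \<in> undirected_edges G2" "w \<in> g" using inc2 by blast
        then show ?thesis
          using \<open>x = Inl (Inr e)\<close> \<open>b = Inr (Inl w)\<close> by (intro exI[of _ "Inr (Inr g)"]) simp
      next
        case (4 g)
        then have "g \<in> undirected_edges G2" using b verts by simp
        then show ?thesis
          using e \<open>x = Inl (Inr e)\<close> \<open>b = Inr (Inr g)\<close> by (intro exI[of _ x]) simp
      qed
    next
      \<comment> \<open>The last two cases mirror the first two with the graphs interchanged;
        \<open>e01\<close> now serves for detours.\<close>
      case (3 u)
      then have u: "u \<in> pverts G2" using x verts by simp
      then obtain eu where eu: "eu \<in> undirected_edges G2" "u \<in> eu" using inc2 by blast
      show ?thesis
      proof (cases b rule: join_vertex_cases)
        case (3 v)
        with b \<open>x = Inr (Inl u)\<close> have v: "v \<in> pverts G2" "v \<noteq> u" using verts by auto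
        show ?thesis
        proof (cases "(u, v) \<in> parcs G2")
          case True
          then show ?thesis
            using v \<open>x = Inr (Inl u)\<close> \<open>b = Inr (Inl v)\<close>
            by (intro exI[of _ "Inr (Inr {u, v})"]) (simp add: G2.insert_in_undirected_edges)
        next
          case False
          obtain e where e: "e \<in> undirected_edges G2" "v \<in> e" using inc2 v(1) by blast
          then have "u \<notin> e" using False v(2) G2.arc_of_undirected_edge by blast
          with e False show ?thesis
            using v \<open>x = Inr (Inl u)\<close> \<open>b = Inr (Inl v)\<close> by (intro exI[of _ "Inr (Inr e)"]) simp
        qed
      next
        case (4 e)
        then have "e \<in> undirected_edges G2" using b verts by simp
        then show ?thesis
          using \<open>x = Inr (Inl u)\<close> \<open>b = Inr (Inr e)\<close> edge0
          by (intro exI[of _ "if u \<in> e then x else Inl (Inr e01)"]) simp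
      next
        case (1 w)
        then have "w \<in> pverts G1" using b verts by simp
        then obtain g where "g \<in> undirected_edges G1" "w \<in> g" using inc1 by blast
        then show ?thesis
          using \<open>x = Inr (Inl u)\<close> \<open>b = Inl (Inl w)\<close> by (intro exI[of _ "Inl (Inr g)"]) simp
      next
        case (2 g)
        then have "g \<in> undirected_edges G1" using b verts by simp
        then show ?thesis
          using eu \<open>x = Inr (Inl u)\<close> \<open>b = Inl (Inr g)\<close> by (intro exI[of _ "Inr (Inr eu)"]) simp
      qed
    next
      case (4 e)
      then have e: "e \<in> undirected_edges G2" using x verts by simp
      show ?thesis
      proof (cases b rule: join_vertex_cases)
        case (3 v)
        then have "v \<in> pverts G2" using b verts by simp
        then obtain f where "f \<in> undirected_edges G2" "v \<in> f" using inc2 by blast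
        then show ?thesis
          using e \<open>x = Inr (Inr e)\<close> \<open>b = Inr (Inl v)\<close>
          by (intro exI[of _ "Inr (Inr (if v \<in> e then e else f))"]) auto
      next
        case (4 f)
        with b \<open>x = Inr (Inr e)\<close> have "f \<in> undirected_edges G2" "f \<noteq> e" using verts by auto
        then show ?thesis
          using \<open>x = Inr (Inr e)\<close> \<open>b = Inr (Inr f)\<close> edge0
          by (intro exI[of _ "Inl (Inr e01)"]) simp
      next
        case (1 w)
        then have "w \<in> pverts G1" using b verts by simp
        then obtain g where "g \<in> undirected_edges G1" "w \<in> g" using inc1 by blast
        then show ?thesis
          using \<open>x = Inr (Inr e)\<close> \<open>b = Inl (Inl w)\<close> by (intro exI[of _ "Inl (Inr g)"]) simp
      next
        case (2 g)
        then have "g \<in> undirected_edges G1" using b verts by simp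
        then show ?thesis
          using e \<open>x = Inr (Inr e)\<close> \<open>b = Inl (Inr g)\<close> by (intro exI[of _ x]) simp
      qed
    qed
  qed
qed

section \<open>Incidences and spectra of regular graphs\<close>

context
  fixes G :: "'a pair_pre_digraph" and r :: nat
  assumes reg: "regular_graph r G"
begin

interpretation pair_graph G
  using reg by (simp add: regular_graph_def)

lemma card_neighbours:
  assumes "u \<in> pverts G"
  shows "card {v. (u, v) \<in> parcs G} = r"
proof -
  have "out_arcs (with_proj G) u = Pair u ` {v. (u, v) \<in> parcs G}"
    by (auto simp: out_arcs_def)
  then have "card {v. (u, v) \<in> parcs G} = out_degree (with_proj G) u"
    by (simp add: out_degree_def card_image inj_on_def)
  with assms reg show ?thesis by (simp add: regular_graph_def)
qed

lemma sum_adjacent: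
  assumes "u \<in> pverts G"
  shows "(\<Sum>v\<in>pverts G. of_bool ((u, v) \<in> parcs G)) = (of_nat r :: 'c :: semiring_1)"
proof -
  have "pverts G \<inter> {v. (u, v) \<in> parcs G} = {v. (u, v) \<in> parcs G}"
    using in_arcsD2 by auto
  then show ?thesis
    using card_neighbours[OF assms] by (simp add: sum_of_bool_eq pair_finite_verts)
qed

text \<open>Edges at \<open>u\<close> correspond to its neighbours through
  \<open>\<lambda>v. {u, v}\<close>.\<close>

lemma card_incident_edges:
  assumes "u \<in> pverts G"
  shows "card {e \<in> undirected_edges G. u \<in> e} = r"
proof -
  have "{e \<in> undirected_edges G. u \<in> e} = (\<lambda>v. {u, v}) ` {v. (u, v) \<in> parcs G}"
    using insert_in_undirected_edges arc_sym by (auto elim!: undirected_edgeE)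
  moreover have "inj_on (\<lambda>v. {u, v}) {v. (u, v) \<in> parcs G}"
    by (auto simp: inj_on_def doubleton_eq_iff)
  ultimately show ?thesis
    using card_neighbours[OF assms] by (simp add: card_image)
qed

lemma sum_incident:
  assumes "u \<in> pverts G"
  shows "(\<Sum>e\<in>undirected_edges G. of_bool (u \<in> e)) = (of_nat r :: 'c :: semiring_1)"
  using card_incident_edges[OF assms] finite_undirected_edges by (simp add: sum_of_bool_eq Int_def)

text \<open>This is \<open>B B^T = A + r I\<close> entrywise for the incidence matrix
  \<open>B\<close>: the diagonal counts the \<open>r\<close> edges at a vertex, and off the diagonal
  two vertices share at most one edge.\<close>

lemma sum_incident_mult:
  assumes "u \<in> pverts G"
  shows "(\<Sum>e\<in>undirected_edges G. of_bool (u \<in> e) * of_bool (v \<in> e)) =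
     (of_bool ((u, v) \<in> parcs G) + of_nat r * of_bool (u = v) :: 'c :: semiring_1)"
proof (cases "u = v")
  case True
  then show ?thesis
    using sum_incident[OF assms, where 'c = 'c] no_loops' by (auto simp flip: of_bool_conj)
next
  case False
  then have "{e \<in> undirected_edges G. u \<in> e \<and> v \<in> e} = (if (u, v) \<in> parcs G then {{u, v}} else {})"
    using undirected_edge_eq insert_in_undirected_edges by fastforce
  then have "card {e \<in> undirected_edges G. u \<in> e \<and> v \<in> e} = of_bool ((u, v) \<in> parcs G)"
    by simp
  then show ?thesis
    using False finite_undirected_edges by (simp add: sum_of_bool_eq Int_def flip: of_bool_conj)
qed

lemma sum_ends:
  assumes "e \<in> undirected_edges G"
  shows "(\<Sum>v\<in>pverts G. of_bool (v \<in> e)) = (2 :: 'c :: semiring_1)"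
proof -
  obtain u v where e: "e = {u, v}" "u \<noteq> v" "u \<in> pverts G" "v \<in> pverts G"
    using assms by (rule undirected_edgeE)
  then have "pverts G \<inter> {v. v \<in> e} = {u, v}" by auto
  then show ?thesis using e by (simp add: sum_of_bool_eq pair_finite_verts)
qed

text \<open>Incidences are counted from both sides; this supplies the edge number
  \<open>p r / 2\<close>.\<close>

lemma handshake: "2 * card (undirected_edges G) = r * card (pverts G)"
proof -
  have "(\<Sum>u\<in>pverts G. \<Sum>e\<in>undirected_edges G. of_bool (u \<in> e)) =
      (\<Sum>e\<in>undirected_edges G. \<Sum>u\<in>pverts G. of_bool (u \<in> e) :: nat)"
    by (rule sum.swap)
  also have "\<dots> = 2 * card (undirected_edges G)"
    by (simp add: sum_ends del: sum_of_bool_eq)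
  finally show ?thesis by (simp add: sum_incident mult.commute del: sum_of_bool_eq)
qed

lemma ex_incident_edge:
  assumes "r > 0" "u \<in> pverts G"
  shows "\<exists>e\<in>undirected_edges G. u \<in> e"
proof -
  have "{e \<in> undirected_edges G. u \<in> e} \<noteq> {}"
    using card_incident_edges[OF assms(2)] assms(1) by (metis card.empty less_irrefl)
  then show ?thesis by blast
qed

end

section \<open>Roots of characteristic polynomials and bounds for adjacency eigenvalues\<close>

lemma proots_prod_linear: "proots (\<Prod>z\<in>#M. [:- z, 1 :: 'a :: idom:]) = M"
proof (induction M)
  case (add x M)
  have "(\<Prod>z\<in>#M. [:- z, 1:]) \<noteq> (0 :: 'a poly)"
    by (auto simp: prod_mset_zero_iff)
  with add show ?case
    by (simp add: proots_mult del: mult_pCons_left)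
qed simp

lemma monic_char_poly:
  assumes "A \<in> carrier_mat n n"
  shows "monic (char_poly A)" "char_poly A \<noteq> 0"
  using degree_monic_char_poly[OF assms] by auto

lemma size_eigenvalues_mset:
  assumes "A \<in> carrier_mat n n"
  shows "size (eigenvalues_mset A) = n"
  using degree_monic_char_poly[of "map_mat complex_of_real A" n] assms
  by (simp add: eigenvalues_mset_def size_proots_complex)

text \<open>For nonzero \<open>\<beta>\<close>, pulling it out of the determinant leaves the
  characteristic polynomial at \<open>\<alpha> / \<beta>\<close>, which splits over the complex
  numbers. The case \<open>\<beta> = 0\<close> does arise: \<open>\<beta>\<close> will be
  \<open>2 * y + 4\<close>.\<close>

lemma det_scalar_minus_kernel_mat:
  fixes f :: "'a \<Rightarrow> 'a \<Rightarrow> real" and \<alpha> \<beta> :: complex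
  assumes xs: "distinct xs"
  shows "det (kernel_mat (\<lambda>x y. \<alpha> * of_bool (x = y) - \<beta> * complex_of_real (f x y)) xs xs) =
     (\<Prod>l\<in>#eigenvalues_mset (kernel_mat f xs xs). \<alpha> - \<beta> * l)"
proof -
  let ?M = "eigenvalues_mset (kernel_mat f xs xs)" and ?n = "length xs"
  let ?A = "kernel_mat (\<lambda>x y. complex_of_real (f x y)) xs xs"
  have size: "size ?M = ?n"
    by (rule size_eigenvalues_mset) simp
  show ?thesis
  proof (cases "\<beta> = 0")
    case True
    have "kernel_mat (\<lambda>x y. \<alpha> * of_bool (x = y)) xs xs = \<alpha> \<cdot>\<^sub>m 1\<^sub>m ?n"
      by (rule eq_matI) (auto simp: kernel_mat_def nth_eq_iff_index_eq xs)
    with True size show ?thesis by simp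
  next
    case False
    have map: "map_mat complex_of_real (kernel_mat f xs xs) = ?A"
      by (rule eq_matI) (auto simp: kernel_mat_def)
    have char: "char_poly ?A = (\<Prod>l\<in>#?M. [:- l, 1:])"
      using complex_poly_decompose_multiset[of "char_poly ?A"] monic_char_poly(1)[of ?A ?n]
      by (simp add: eigenvalues_mset_def map)
    have "kernel_mat (\<lambda>x y. \<alpha> * of_bool (x = y) - \<beta> * complex_of_real (f x y)) xs xs =
        \<beta> \<cdot>\<^sub>m kernel_mat (\<lambda>x y. \<alpha> / \<beta> * of_bool (x = y) - complex_of_real (f x y)) xs xs"
      by (rule eq_matI) (use False in \<open>auto simp: kernel_mat_def algebra_simps\<close>)
    also have "det \<dots> = \<beta> ^ ?n * poly (char_poly ?A) (\<alpha> / \<beta>)"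
      by (simp add: poly_char_poly_kernel_mat[OF xs])
    also have "\<dots> = (\<Prod>l\<in>#?M. \<beta> * (\<alpha> / \<beta> - l))"
      by (simp add: char poly_prod_mset prod_mset.distrib size multiset.map_comp comp_def)
    also have "\<dots> = (\<Prod>l\<in>#?M. \<alpha> - \<beta> * l)"
      using False by (simp add: algebra_simps)
    finally show ?thesis .
  qed
qed

text \<open>A Gershgorin-type argument: the eigenvalue equation is read off at a coordinate of
  largest absolute value.\<close>

lemma eigenvalue_abs_le_row_sum:
  fixes A :: "real mat"
  assumes A: "A \<in> carrier_mat n n" and "eigenvalue A l"
    and rows: "\<And>i. i < n \<Longrightarrow> (\<Sum>j<n. \<bar>A $$ (i, j)\<bar>) \<le> R"
  shows "\<bar>l\<bar> \<le> R"
proof -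
  obtain v where v: "v \<in> carrier_vec n" "v \<noteq> 0\<^sub>v n" and Av: "A *\<^sub>v v = l \<cdot>\<^sub>v v"
    using assms(2) A by (auto simp: eigenvalue_def eigenvector_def)
  obtain k where k: "k < n" "v $ k \<noteq> 0"
    using v by (metis carrier_vecD eq_vecI index_zero_vec)
  let ?S = "(\<lambda>j. \<bar>v $ j\<bar>) ` {..<n}"
  have "Max ?S \<in> ?S" using k(1) by (intro Max_in) auto
  then obtain i where i: "i < n" and "\<bar>v $ i\<bar> = Max ?S" by auto
  then have max: "\<bar>v $ j\<bar> \<le> \<bar>v $ i\<bar>" if "j < n" for j
    using that by simp
  have "l * v $ i = (\<Sum>j<n. A $$ (i, j) * v $ j)"
    using arg_cong[OF Av, of "\<lambda>w. w $ i"] i A v(1)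
    by (simp add: scalar_prod_def atLeast0LessThan)
  then have "\<bar>l\<bar> * \<bar>v $ i\<bar> \<le> (\<Sum>j<n. \<bar>A $$ (i, j)\<bar> * \<bar>v $ j\<bar>)"
    by (metis (no_types, lifting) abs_mult sum.cong sum_abs)
  also have "\<dots> \<le> (\<Sum>j<n. \<bar>A $$ (i, j)\<bar> * \<bar>v $ i\<bar>)"
    by (intro sum_mono mult_left_mono max) auto
  also have "\<dots> \<le> R * \<bar>v $ i\<bar>"
    using rows[OF i] by (simp add: mult_right_mono flip: sum_distrib_right)
  finally have "\<bar>l\<bar> * \<bar>v $ i\<bar> \<le> R * \<bar>v $ i\<bar>" .
  moreover have "0 < \<bar>v $ i\<bar>"
    using max[OF k(1)] k(2) by linarith
  ultimately show ?thesis by (simp only: mult_le_cancel_right_pos)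
qed

lemma adjacency_matrix_eq_kernel_mat:
  "adjacency_matrix G vs = kernel_mat (\<lambda>u v. of_bool ((u, v) \<in> parcs G)) vs vs"
  by (auto simp: adjacency_matrix_def kernel_mat_def)

text \<open>All absolute row sums equal \<open>r\<close>. The bound later makes the discriminants
  non-negative.\<close>

lemma adjacency_eigenvalue_ge:
  assumes reg: "regular_graph r G" and vs: "distinct vs" "set vs = pverts G"
    and l: "complex_of_real l \<in># eigenvalues_mset (adjacency_matrix G vs)"
  shows "- real r \<le> l"
proof -
  let ?A = "adjacency_matrix G vs"
  have A: "?A \<in> carrier_mat (length vs) (length vs)"
    by (simp add: adjacency_matrix_def)
  have "poly (char_poly (map_mat complex_of_real ?A)) (complex_of_real l) = 0"
    using l monic_char_poly(2)[of "map_mat complex_of_real ?A" "length vs"] A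
    by (simp add: eigenvalues_mset_def)
  then have "eigenvalue ?A l"
    by (simp add: of_real_hom.char_poly_hom[OF A] eigenvalue_root_char_poly[OF A])
  then have "\<bar>l\<bar> \<le> real r"
  proof (rule eigenvalue_abs_le_row_sum[OF A])
    fix i assume i: "i < length vs"
    have "(\<Sum>j<length vs. \<bar>?A $$ (i, j)\<bar>) = (\<Sum>j<length vs. of_bool ((vs ! i, vs ! j) \<in> parcs G))"
      using i by (intro sum.cong) (simp_all add: adjacency_matrix_def)
    also have "\<dots> = (\<Sum>v\<in>pverts G. of_bool ((vs ! i, v) \<in> parcs G))"
      using vs by (intro sum.reindex_bij_betw bij_betw_nth) auto
    also have "\<dots> = real r"
      by (rule sum_adjacent[OF reg]) (use nth_mem[OF i] vs(2) in simp)
    finally show "(\<Sum>j<length vs. \<bar>?A $$ (i, j)\<bar>) \<le> real r" by simp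
  qed
  then show ?thesis by simp
qed

section \<open>The characteristic polynomial of the join\<close>

text \<open>One diagonal block of \<open>X\<close>: what remains of \<open>z I - L\<close> on one
  graph once the constant distances between classes are subtracted. The parameters \<open>a\<close>
  and \<open>y\<close> are the diagonal entries at old and at new vertices.\<close>

fun subdivision_kernel ::
  "'a pair_pre_digraph \<Rightarrow> complex \<Rightarrow> complex \<Rightarrow> 'a + 'a set \<Rightarrow> 'a + 'a set \<Rightarrow> complex" where
  "subdivision_kernel G a y (Inl u) (Inl v) = a * of_bool (u = v) - 2 * of_bool ((u, v) \<in> parcs G)"
| "subdivision_kernel G a y (Inl u) (Inr e) = - 2 * of_bool (u \<in> e)"
| "subdivision_kernel G a y (Inr e) (Inl u) = - 2 * of_bool (u \<in> e)"
| "subdivision_kernel G a y (Inr e) (Inr f) = y * of_bool (e = f)"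

text \<open>The new vertices contribute the scalar block \<open>y I\<close>, so the Schur complement
  applies. By \<open>sum_incident_mult\<close> it is a linear polynomial in the adjacency matrix, so
  each adjacency eigenvalue contributes one factor.\<close>

lemma det_subdivision_kernel:
  assumes reg: "regular_graph r G"
    and vs: "distinct vs" "set vs = pverts G" and es: "distinct es" "set es = undirected_edges G"
  shows "y ^ length vs * det (kernel_mat (subdivision_kernel G a y) (map Inl vs @ map Inr es) (map Inl vs @ map Inr es))
    = y ^ length es * (\<Prod>l\<in>#eigenvalues_mset (adjacency_matrix G vs). y * (a - 2 * l) - 4 * (l + of_nat r))"
proof -
  interpret pair_graph G
    using reg by (simp add: regular_graph_def)
  let ?P = "kernel_mat (\<lambda>u v. a * of_bool (u = v) - 2 * of_bool ((u, v) \<in> parcs G)) vs vs"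
  let ?B = "kernel_mat (\<lambda>u e. - 2 * of_bool (u \<in> e)) vs es :: complex mat"
  let ?C = "kernel_mat (\<lambda>e u. - 2 * of_bool (u \<in> e)) es vs :: complex mat"
  have "kernel_mat (\<lambda>e f. y * of_bool (e = f)) es es = y \<cdot>\<^sub>m 1\<^sub>m (length es)"
    by (rule eq_matI) (auto simp: kernel_mat_def nth_eq_iff_index_eq es)
  then have "kernel_mat (subdivision_kernel G a y) (map Inl vs @ map Inr es) (map Inl vs @ map Inr es) =
      four_block_mat ?P ?B ?C (y \<cdot>\<^sub>m 1\<^sub>m (length es))"
    by (simp add: kernel_mat_append kernel_mat_map)
  then have "y ^ length vs * det (kernel_mat (subdivision_kernel G a y) (map Inl vs @ map Inr es) (map Inl vs @ map Inr es))
      = y ^ length es * det (y \<cdot>\<^sub>m ?P - ?B * ?C)"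
    by (simp add: det_four_block_scalar[of _ "length vs" _ "length es"])
  also have "y \<cdot>\<^sub>m ?P - ?B * ?C = kernel_mat (\<lambda>u v. (y * a - 4 * of_nat r) * of_bool (u = v) -
      (2 * y + 4) * complex_of_real (of_bool ((u, v) \<in> parcs G))) vs vs"
  proof -
    \<comment> \<open>The factor 4 is the product of the two entries \<open>- 2\<close> in the
      off-diagonal blocks.\<close>
    have "?B * ?C = kernel_mat (\<lambda>u v. \<Sum>e\<in>undirected_edges G. 4 * (of_bool (u \<in> e) * of_bool (v \<in> e))) vs vs"
      by (auto simp: kernel_mat_mult es intro!: kernel_mat_cong sum.cong)
    also have "\<dots> = kernel_mat (\<lambda>u v. 4 * (of_bool ((u, v) \<in> parcs G) + of_nat r * of_bool (u = v))) vs vs"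
      by (rule kernel_mat_cong)
        (simp add: vs sum_incident_mult[OF reg] del: of_bool_conj flip: sum_distrib_left)
    finally show ?thesis
      by (simp only:) (rule eq_matI, auto simp: kernel_mat_def algebra_simps)
  qed
  also have "det \<dots> = (\<Prod>l\<in>#eigenvalues_mset (adjacency_matrix G vs). y * (a - 2 * l) - 4 * (l + of_nat r))"
    by (simp only: det_scalar_minus_kernel_mat[OF vs(1)] adjacency_matrix_eq_kernel_mat) (simp add: algebra_simps)
  finally show ?thesis .
qed

text \<open>Regularity makes every block row sum constant on its class; these sums are the entries
  of \<open>kernel_quotient\<close>.\<close>

lemma sum_subdivision_kernel:
  assumes reg: "regular_graph r G"
  shows
    "u \<in> pverts G \<Longrightarrow> (\<Sum>v\<in>pverts G. subdivision_kernel G a y (Inl u) (Inl v)) = a - 2 * of_nat r"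
    "u \<in> pverts G \<Longrightarrow> (\<Sum>e\<in>undirected_edges G. subdivision_kernel G a y (Inl u) (Inr e)) = - 2 * of_nat r"
    "e \<in> undirected_edges G \<Longrightarrow> (\<Sum>v\<in>pverts G. subdivision_kernel G a y (Inr e) (Inl v)) = - 4"
    "e \<in> undirected_edges G \<Longrightarrow> (\<Sum>f\<in>undirected_edges G. subdivision_kernel G a y (Inr e) (Inr f)) = y"
proof -
  interpret pair_graph G
    using reg by (simp add: regular_graph_def)
  have single: "(\<Sum>x\<in>A. of_bool (z = x)) = (1 :: complex)" if "finite A" "z \<in> A" for A and z :: 'b
    using that by (simp add: of_bool_def sum.delta)
  show "(\<Sum>v\<in>pverts G. subdivision_kernel G a y (Inl u) (Inl v)) = a - 2 * of_nat r" if "u \<in> pverts G"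
    using that unfolding subdivision_kernel.simps sum_subtractf
    by (simp only: single pair_finite_verts sum_adjacent[OF reg] mult_1_right flip: sum_distrib_left)
  show "(\<Sum>e\<in>undirected_edges G. subdivision_kernel G a y (Inl u) (Inr e)) = - 2 * of_nat r"
    if "u \<in> pverts G"
    using that unfolding subdivision_kernel.simps
    by (simp only: sum_incident[OF reg] flip: sum_distrib_left)
  show "(\<Sum>v\<in>pverts G. subdivision_kernel G a y (Inr e) (Inl v)) = - 4" if "e \<in> undirected_edges G"
    using that unfolding subdivision_kernel.simps
    by (simp only: sum_ends[OF reg] flip: sum_distrib_left) simp
  show "(\<Sum>f\<in>undirected_edges G. subdivision_kernel G a y (Inr e) (Inr f)) = y"
    if "e \<in> undirected_edges G"
    using that unfolding subdivision_kernel.simps by (simp only: single finite_undirected_edges mult_1_right flip: sum_distrib_left)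
qed

section \<open>The quotient by the four vertex classes\<close>

lemma det_kernel_mat_2:
  fixes f :: "'a \<Rightarrow> 'a \<Rightarrow> 'c :: comm_ring_1"
  shows "det (kernel_mat f [x, y] [x, y]) = f x x * f y y - f x y * f y x"
  by (subst laplace_expansion_row[of _ 2 0])
    (auto simp: kernel_mat_def cofactor_def mat_delete_def det_single numeral_2_eq_2)

fun join_kernel ::
  "(('a + 'a set) \<Rightarrow> ('a + 'a set) \<Rightarrow> complex) \<Rightarrow> (('b + 'b set) \<Rightarrow> ('b + 'b set) \<Rightarrow> complex) \<Rightarrow>
    ('a + 'a set) + ('b + 'b set) \<Rightarrow> ('a + 'a set) + ('b + 'b set) \<Rightarrow> complex" where
  "join_kernel K1 K2 (Inl x) (Inl y) = K1 x y"
| "join_kernel K1 K2 (Inr x) (Inr y) = K2 x y"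
| "join_kernel K1 K2 (Inl x) (Inr y) = 0"
| "join_kernel K1 K2 (Inr x) (Inl y) = 0"

lemma det_join_kernel:
  fixes xs :: "('a + 'a set) list" and ys :: "('b + 'b set) list"
  shows "det (kernel_mat (join_kernel K1 K2) (map Inl xs @ map Inr ys) (map Inl xs @ map Inr ys)) =
    det (kernel_mat K1 xs xs) * det (kernel_mat K2 ys ys)"
proof -
  have zero: "kernel_mat (\<lambda>x y. 0) ys xs = (0\<^sub>m (length ys) (length xs) :: complex mat)"
    by (rule eq_matI) (auto simp: kernel_mat_def)
  show ?thesis
    by (simp add: kernel_mat_append kernel_mat_map zero
        det_four_block_mat_lower_left_zero[of _ "length xs" _ "length ys"])
qed

text \<open>The numbering is the row order of \<open>quotient_matrix\<close>.\<close>

fun vertex_class :: "('a + 'b) + ('c + 'd) \<Rightarrow> nat" where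
  "vertex_class (Inl (Inl _)) = 0"
| "vertex_class (Inl (Inr _)) = 1"
| "vertex_class (Inr (Inl _)) = 2"
| "vertex_class (Inr (Inr _)) = 3"

text \<open>The distance between two vertices of the given classes that are neither equal nor, within one of
  the two graphs, adjacent or incident.\<close>

definition class_dist :: "nat \<Rightarrow> nat \<Rightarrow> complex" where
  "class_dist i j = [[4, 3, 3, 2], [3, 2, 2, 1], [3, 2, 4, 3], [2, 1, 3, 2]] ! i ! j"

text \<open>Row sums of the block diagonal kernel over the four classes, that is, \<open>Y\<close>
  in \<open>X U = U Y\<close>.\<close>

definition kernel_quotient ::
  "complex \<Rightarrow> complex \<Rightarrow> complex \<Rightarrow> complex \<Rightarrow> complex \<Rightarrow> complex \<Rightarrow> nat \<Rightarrow> nat \<Rightarrow> complex" where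
  "kernel_quotient r1 a1 y1 r2 a2 y2 i j =
     [[a1 - 2 * r1, - 2 * r1, 0, 0], [- 4, y1, 0, 0],
      [0, 0, a2 - 2 * r2, - 2 * r2], [0, 0, - 4, y2]] ! i ! j"

text \<open>Each factor is the one that \<open>det_subdivision_kernel\<close> yields at the
  eigenvalue \<open>l = r\<close>, so it can be cancelled later.\<close>

lemma det_kernel_quotient:
  "det (kernel_mat (kernel_quotient r1 a1 y1 r2 a2 y2) [0..<4] [0..<4]) =
     (y1 * (a1 - 2 * r1) - 8 * r1) * (y2 * (a2 - 2 * r2) - 8 * r2)"
proof -
  let ?f = "kernel_quotient r1 a1 y1 r2 a2 y2"
  have upt: "[0..<4] = [0, 1] @ [2, 3 :: nat]"
    by (simp add: upt_rec)
  have zero: "kernel_mat ?f [2, 3] [0, 1] = 0\<^sub>m 2 2"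
    by (rule eq_matI) (auto simp: kernel_mat_def kernel_quotient_def less_2_cases_iff)
  have "det (kernel_mat ?f [0..<4] [0..<4]) = det (kernel_mat ?f [0, 1] [0, 1]) * det (kernel_mat ?f [2, 3] [2, 3])"
    unfolding upt kernel_mat_append zero
    by (rule det_four_block_mat_lower_left_zero[of _ 2 _ 2]) (auto simp: kernel_mat_def)
  then show ?thesis
    by (simp add: det_kernel_mat_2 kernel_quotient_def algebra_simps)
qed

lemma sum_pverts_subdivision_edge_join:
  assumes "pair_graph G1" "pair_graph G2"
  shows "sum f (pverts (subdivision_edge_join G1 G2)) =
    (\<Sum>u\<in>pverts G1. f (Inl (Inl u))) + (\<Sum>e\<in>undirected_edges G1. f (Inl (Inr e))) +
    ((\<Sum>w\<in>pverts G2. f (Inr (Inl w))) + (\<Sum>g\<in>undirected_edges G2. f (Inr (Inr g))))"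
proof -
  interpret G1: pair_graph G1 by fact
  interpret G2: pair_graph G2 by fact
  show ?thesis
    by (simp add: pverts_subdivision_edge_join sum.Plus G1.pair_finite_verts G2.pair_finite_verts
        G1.finite_undirected_edges G2.finite_undirected_edges comp_def)
qed

text \<open>An instance of \<open>det_add_mult_intertwined\<close>: the class distances form a
  perturbation \<open>U C U^T\<close> of rank at most 4, and \<open>U^T U\<close> is diagonal with
  the class sizes \<open>n\<close>.\<close>

lemma det_join_kernel_add_class_dist:
  fixes G1 :: "'a pair_pre_digraph" and G2 :: "'b pair_pre_digraph" and a1 y1 a2 y2 :: complex
  assumes reg1: "regular_graph r1 G1" and reg2: "regular_graph r2 G2"
    and vs: "distinct vs" "set vs = pverts (subdivision_edge_join G1 G2)"
  defines "X \<equiv> join_kernel (subdivision_kernel G1 a1 y1) (subdivision_kernel G2 a2 y2)"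
    and "Y \<equiv> kernel_quotient (of_nat r1) a1 y1 (of_nat r2) a2 y2"
    and "n \<equiv> (\<lambda>i. of_nat ([card (pverts G1), card (undirected_edges G1),
      card (pverts G2), card (undirected_edges G2)] ! i))"
  shows "det (kernel_mat (\<lambda>x y. X x y + class_dist (vertex_class x) (vertex_class y)) vs vs) *
      det (kernel_mat Y [0..<4] [0..<4]) =
    det (kernel_mat X vs vs) * det (kernel_mat (\<lambda>i j. Y i j + class_dist i j * n j) [0..<4] [0..<4])"
proof -
  interpret G1: pair_graph G1 using reg1 by (simp add: regular_graph_def)
  interpret G2: pair_graph G2 using reg2 by (simp add: regular_graph_def)
  note sum_J = sum_pverts_subdivision_edge_join[OF G1.pair_graph_axioms G2.pair_graph_axioms]
  let ?U = "kernel_mat (\<lambda>x i. of_bool (vertex_class x = i)) vs [0..<4] :: complex mat"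
  \<comment> \<open>The minus sign makes \<open>X - U * W\<close> add the class distances.\<close>
  let ?W = "kernel_mat (\<lambda>i x. - class_dist i (vertex_class x)) [0..<4] vs"
  let ?X = "kernel_mat X vs vs" and ?Y = "kernel_mat Y [0..<4] [0..<4]"
  have class_less: "vertex_class x < 4" for x :: "('a + 'a set) + ('b + 'b set)"
    by (cases x rule: join_vertex_cases) simp_all
  have upt: "set [0..<4] = {0, 1, 2, 3}" by auto
  have sum_class: "(\<Sum>i\<in>set [0..<4]. of_bool (vertex_class x = i) * f i) = f (vertex_class x)"
    for f :: "nat \<Rightarrow> complex" and x :: "('a + 'a set) + ('b + 'b set)"
    using class_less[of x] by (simp add: if_distrib[of "\<lambda>t. t * _"] of_bool_def sum.delta cong: if_cong)
  \<comment> \<open>The sum over a class depends only on the class of \<open>x\<close>; this is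
    \<open>X U = U Y\<close> entrywise.\<close>
  have row: "(\<Sum>z\<in>set vs. X x z * of_bool (vertex_class z = i)) = Y (vertex_class x) i"
    if x: "x \<in> set vs" and i: "i \<in> {0, 1, 2, 3}" for x i
    using x i unfolding vs(2) sum_J X_def Y_def kernel_quotient_def
    by (cases x rule: join_vertex_cases)
      (auto simp: pverts_subdivision_edge_join sum_subdivision_kernel[OF reg1] sum_subdivision_kernel[OF reg2]
        simp del: subdivision_kernel.simps sum_mult_of_bool_eq)
  have XU: "?X * ?U = ?U * ?Y"
    unfolding kernel_mat_mult[OF vs(1)] kernel_mat_mult[OF distinct_upt] sum_class
    by (rule kernel_mat_cong) (use row upt in blast)
  have UW: "?X - ?U * ?W = kernel_mat (\<lambda>x y. X x y + class_dist (vertex_class x) (vertex_class y)) vs vs"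
    unfolding kernel_mat_mult[OF distinct_upt] sum_class
    by (rule eq_matI) (auto simp: kernel_mat_def)
  have col: "(\<Sum>x\<in>set vs. - class_dist i (vertex_class x) * of_bool (vertex_class x = j)) = - class_dist i j * n j"
    if "j \<in> {0, 1, 2, 3}" for i j
    using that unfolding vs(2) sum_J n_def by (auto simp del: sum_mult_of_bool_eq)
  have "?W * ?U = kernel_mat (\<lambda>i j. - class_dist i j * n j) [0..<4] [0..<4]"
    unfolding kernel_mat_mult[OF vs(1)]
    by (rule kernel_mat_cong) (use col upt in blast)
  then have "?Y - ?W * ?U = kernel_mat (\<lambda>i j. Y i j + class_dist i j * n j) [0..<4] [0..<4]"
    by (simp only:) (rule eq_matI, auto simp: kernel_mat_def)
  with UW show ?thesis
    using det_add_mult_intertwined[of ?X _ ?U _ ?W ?Y,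
        OF kernel_mat_carrier kernel_mat_carrier kernel_mat_carrier kernel_mat_carrier XU]
    by simp
qed

text \<open>With diagonals \<open>- 4\<close> and \<open>- 2\<close> the kernel is exactly the
  correction for equal, adjacent and incident vertices, since 4 and 2 are the class distances of old
  and of new vertices to their own class. Absence of loops keeps equality and adjacency from
  overlapping.\<close>

lemma of_real_join_dist:
  assumes "pair_graph G1" "pair_graph G2"
  shows "complex_of_real (real (join_dist G1 G2 x y)) = class_dist (vertex_class x) (vertex_class y) +
    join_kernel (subdivision_kernel G1 (- 4) (- 2)) (subdivision_kernel G2 (- 4) (- 2)) x y"
proof -
  interpret G1: pair_graph G1 by fact
  interpret G2: pair_graph G2 by fact
  have "(u, u) \<notin> parcs G1" "(w, w) \<notin> parcs G2" for u w
    using G1.no_loops' G2.no_loops' by blast+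
  then show ?thesis
    by (cases x rule: join_vertex_cases; cases y rule: join_vertex_cases) (auto simp: class_dist_def)
qed

text \<open>The transmission of an old vertex plus 4, the distance of its class to itself in
  \<open>class_dist\<close>. Likewise \<open>edge_diagonal\<close> is the transmission of a new
  vertex plus 2; it is also the eigenvalue listed with multiplicity
  \<open>p r / 2 - p\<close>.\<close>

definition vertex_diagonal :: "real \<Rightarrow> real \<Rightarrow> real \<Rightarrow> real \<Rightarrow> real" where
  "vertex_diagonal p1 r1 p2 r2 = 4 * p1 + 3/2 * p1 * r1 + 3 * p2 + p2 * r2 - 4 * r1"

definition edge_diagonal :: "real \<Rightarrow> real \<Rightarrow> real \<Rightarrow> real \<Rightarrow> real" where
  "edge_diagonal p1 r1 p2 r2 = 3 * p1 + p1 * r1 + 2 * p2 + 1/2 * p2 * r2 - 4"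

text \<open>The centre is \<open>(s + t + 2 * l) / 2\<close> and the discriminant is
  \<open>(s - t - 2 * l)^2 + 16 * (l + r1)\<close>, so the pair consists of the roots of the
  quadratic. The bound on \<open>l\<close> ensures that \<open>sqrt\<close> squares back to the
  discriminant; for a negative argument it would square to the absolute value.\<close>

lemma linear_factors_plus_minus_pair:
  fixes p1 r1 p2 r2 l :: real
  assumes l: "- r1 \<le> l"
  defines "t \<equiv> vertex_diagonal p1 r1 p2 r2" and "s \<equiv> edge_diagonal p1 r1 p2 r2"
  shows "poly (\<Prod>w\<in>#plus_minus_pair (centre1 p1 r1 p2 r2 l) (discriminant1 p1 r1 p2 r2 l). [:- w, 1:]) z =
    (z - of_real s) * (z - of_real t - 2 * of_real l) - 4 * (of_real l + of_real r1)"
proof -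
  let ?c = "centre1 p1 r1 p2 r2 l" and ?d = "discriminant1 p1 r1 p2 r2 l"
  have c: "?c = (s + t + 2 * l) / 2"
    by (simp add: centre1_def s_def t_def vertex_diagonal_def edge_diagonal_def field_simps)
  have d: "?d = (s - t - 2 * l)\<^sup>2 + 16 * (l + r1)"
    by (simp add: discriminant1_def s_def t_def vertex_diagonal_def edge_diagonal_def field_simps power2_eq_square)
  have "0 \<le> ?d" using l by (simp add: d)
  then have sq: "(complex_of_real (sqrt ?d))\<^sup>2 = of_real ?d"
    by (simp flip: of_real_power)
  have "poly (\<Prod>w\<in>#plus_minus_pair ?c ?d. [:- w, 1:]) z = (z - of_real ?c)\<^sup>2 - (of_real (sqrt ?d))\<^sup>2 / 4"
    by (simp add: plus_minus_pair_def power2_eq_square algebra_simps)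
  also have "\<dots> = (z - of_real s) * (z - of_real t - 2 * of_real l) - 4 * (of_real l + of_real r1)"
    unfolding sq unfolding c d by (simp add: field_simps power2_eq_square)
  finally show ?thesis .
qed

lemma centre2_eq: "centre2 p1 r1 p2 r2 l = centre1 p2 r2 p1 r1 l"
  by (simp add: centre1_def centre2_def)

lemma discriminant2_eq: "discriminant2 p1 r1 p2 r2 l = discriminant1 p2 r2 p1 r1 l"
  by (simp add: discriminant1_def discriminant2_def algebra_simps)

text \<open>The decomposition \<open>z I - L = X + U C U^T\<close> is verified, and
  \<open>Y + C U^T U\<close> is recognised as \<open>z I - Q\<close> for the quotient matrix
  \<open>Q\<close>. The determinant of \<open>Y\<close> stays a factor on the left, so the identity
  holds for every \<open>z\<close>.\<close>

lemma poly_char_poly_distance_laplacian: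
  fixes G1 :: "'a pair_pre_digraph" and G2 :: "'b pair_pre_digraph" and z :: complex
  assumes reg1: "regular_graph r1 G1" and reg2: "regular_graph r2 G2" and r: "r1 > 0" "r2 > 0"
    and p1: "p1 = card (pverts G1)" "p1 > 0" and p2: "p2 = card (pverts G2)" "p2 > 0"
    and vs: "distinct vs" "set vs = pverts (subdivision_edge_join G1 G2)"
  defines "a1 \<equiv> z - of_real (vertex_diagonal p1 r1 p2 r2)" and "y1 \<equiv> z - of_real (edge_diagonal p1 r1 p2 r2)"
    and "a2 \<equiv> z - of_real (vertex_diagonal p2 r2 p1 r1)" and "y2 \<equiv> z - of_real (edge_diagonal p2 r2 p1 r1)"
  shows "poly (char_poly (map_mat complex_of_real (distance_laplacian_matrix (subdivision_edge_join G1 G2) vs))) z *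
      ((y1 * (a1 - 2 * of_nat r1) - 8 * of_nat r1) * (y2 * (a2 - 2 * of_nat r2) - 8 * of_nat r2)) =
    det (kernel_mat (join_kernel (subdivision_kernel G1 a1 y1) (subdivision_kernel G2 a2 y2)) vs vs) *
      poly (char_poly (map_mat complex_of_real (quotient_matrix p1 r1 p2 r2))) z"
proof -
  interpret G1: pair_graph G1 using reg1 by (simp add: regular_graph_def)
  interpret G2: pair_graph G2 using reg2 by (simp add: regular_graph_def)
  note sum_J = sum_pverts_subdivision_edge_join[OF G1.pair_graph_axioms G2.pair_graph_axioms]
  let ?J = "subdivision_edge_join G1 G2"
  let ?X = "join_kernel (subdivision_kernel G1 a1 y1) (subdivision_kernel G2 a2 y2)"
  let ?Y = "kernel_quotient (of_nat r1) a1 y1 (of_nat r2) a2 y2"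
  let ?n = "\<lambda>i. of_nat ([card (pverts G1), card (undirected_edges G1),
      card (pverts G2), card (undirected_edges G2)] ! i) :: complex"
  have m: "complex_of_nat (card (undirected_edges G1)) = of_nat r1 * of_nat p1 / 2"
    "complex_of_nat (card (undirected_edges G2)) = of_nat r2 * of_nat p2 / 2"
    using arg_cong[OF handshake[OF reg1], of complex_of_nat] arg_cong[OF handshake[OF reg2], of complex_of_nat]
    by (simp_all add: p1 p2 mult.commute)
  have dist: "graph_dist ?J x y = real (join_dist G1 G2 x y)" if "x \<in> set vs" "y \<in> set vs" for x y
  proof (rule graph_dist_subdivision_edge_join)
    show "\<exists>e\<in>undirected_edges G1. u \<in> e" if "u \<in> pverts G1" for u
      by (rule ex_incident_edge[OF reg1 r(1) that])
    show "\<exists>e\<in>undirected_edges G2. u \<in> e" if "u \<in> pverts G2" for u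
      by (rule ex_incident_edge[OF reg2 r(2) that])
  qed (use that vs p1 p2 G1.pair_graph_axioms G2.pair_graph_axioms in auto)
  \<comment> \<open>Transmissions are constant on each class; the summands 4 and 2 lead from the
    shifted diagonals back to \<open>z\<close> minus the transmission.\<close>
  have transmission: "complex_of_real (transmission ?J x) = z - [a1 + 4, y1 + 2, a2 + 4, y2 + 2] ! vertex_class x"
    if "x \<in> set vs" for x
  proof -
    have "complex_of_real (transmission ?J x) = (\<Sum>y\<in>pverts ?J. class_dist (vertex_class x) (vertex_class y)) +
        (\<Sum>y\<in>pverts ?J. join_kernel (subdivision_kernel G1 (- 4) (- 2)) (subdivision_kernel G2 (- 4) (- 2)) x y)"
      using that G1.pair_graph_axioms G2.pair_graph_axioms
      by (simp add: transmission_def dist vs of_real_join_dist del: of_real_of_nat_eq flip: sum.distrib)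
    also have "\<dots> = z - [a1 + 4, y1 + 2, a2 + 4, y2 + 2] ! vertex_class x"
      using that unfolding vs(2) sum_J
      by (cases x rule: join_vertex_cases)
        (auto simp: pverts_subdivision_edge_join sum_subdivision_kernel[OF reg1] sum_subdivision_kernel[OF reg2] m
          class_dist_def a1_def y1_def a2_def y2_def vertex_diagonal_def edge_diagonal_def field_simps
          simp flip: p1(1) p2(1) simp del: subdivision_kernel.simps)
    finally show ?thesis .
  qed
  have kernel: "z * of_bool (x = y) - complex_of_real (transmission ?J x * of_bool (x = y) - graph_dist ?J x y) =
      ?X x y + class_dist (vertex_class x) (vertex_class y)" if "x \<in> set vs" "y \<in> set vs" for x y
  proof -
    have "z * of_bool (x = y) - complex_of_real (transmission ?J x * of_bool (x = y) - graph_dist ?J x y) =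
        (z - complex_of_real (transmission ?J x)) * of_bool (x = y) + complex_of_real (graph_dist ?J x y)"
      by (simp add: algebra_simps)
    also have "\<dots> = [a1 + 4, y1 + 2, a2 + 4, y2 + 2] ! vertex_class x * of_bool (x = y) +
        (class_dist (vertex_class x) (vertex_class y) +
          join_kernel (subdivision_kernel G1 (- 4) (- 2)) (subdivision_kernel G2 (- 4) (- 2)) x y)"
      using of_real_join_dist[OF G1.pair_graph_axioms G2.pair_graph_axioms, of x y]
      by (simp only: dist[OF that] transmission[OF that(1)]) simp
    \<comment> \<open>At \<open>x = y\<close> the summands 4 and 2 cancel the \<open>- 4\<close> and
      \<open>- 2\<close> of the correction kernel.\<close>
    also have "\<dots> = ?X x y + class_dist (vertex_class x) (vertex_class y)"
      by (cases x rule: join_vertex_cases; cases y rule: join_vertex_cases) (auto simp: algebra_simps)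
    finally show ?thesis .
  qed
  have "map_mat complex_of_real (distance_laplacian_matrix ?J vs) =
      kernel_mat (\<lambda>x y. complex_of_real (transmission ?J x * of_bool (x = y) - graph_dist ?J x y)) vs vs"
    by (rule eq_matI)
      (auto simp: distance_laplacian_matrix_def transmission_matrix_def distance_matrix_def kernel_mat_def
        nth_eq_iff_index_eq vs(1))
  then have L: "poly (char_poly (map_mat complex_of_real (distance_laplacian_matrix ?J vs))) z =
      det (kernel_mat (\<lambda>x y. ?X x y + class_dist (vertex_class x) (vertex_class y)) vs vs)"
    by (simp only: poly_char_poly_kernel_mat[OF vs(1)] kernel cong: kernel_mat_cong)
  have "map_mat complex_of_real (quotient_matrix p1 r1 p2 r2) =
      kernel_mat (\<lambda>i j. complex_of_real (quotient_matrix p1 r1 p2 r2 $$ (i, j))) [0..<4] [0..<4]"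
    by (rule eq_matI) (auto simp: kernel_mat_def quotient_matrix_def mat_of_rows_list_def)
  then have "poly (char_poly (map_mat complex_of_real (quotient_matrix p1 r1 p2 r2))) z =
      det (kernel_mat (\<lambda>i j. z * of_bool (i = j) - complex_of_real (quotient_matrix p1 r1 p2 r2 $$ (i, j)))
        [0..<4] [0..<4])"
    by (simp only: poly_char_poly_kernel_mat[OF distinct_upt])
  also have "kernel_mat (\<lambda>i j. z * of_bool (i = j) - complex_of_real (quotient_matrix p1 r1 p2 r2 $$ (i, j)))
        [0..<4] [0..<4] = kernel_mat (\<lambda>i j. ?Y i j + class_dist i j * ?n j) [0..<4] [0..<4]"
  proof (rule kernel_mat_cong)
    fix i j assume "i \<in> set [0..<4]" "j \<in> set [0..<4]"
    then have "i \<in> {0, 1, 2, 3}" "j \<in> {0, 1, 2, 3}" by auto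
    then show "z * of_bool (i = j) - complex_of_real (quotient_matrix p1 r1 p2 r2 $$ (i, j)) =
        ?Y i j + class_dist i j * ?n j"
      by (auto simp: quotient_matrix_def mat_of_rows_list_def kernel_quotient_def class_dist_def m
          a1_def y1_def a2_def y2_def vertex_diagonal_def edge_diagonal_def field_simps simp flip: p1(1) p2(1))
  qed
  finally show ?thesis
    using det_join_kernel_add_class_dist[OF reg1 reg2 vs, of a1 y1 a2 y2] L
    by (simp add: det_kernel_quotient)
qed

lemma prod_mset_sum_singletons:
  "finite A \<Longrightarrow> (\<Prod>x\<in>#(\<Sum>j\<in>A. {#g j#}). F x) = (\<Prod>j\<in>A. F (g j))"
  by (induction A rule: finite_induct) auto

lemma in_sum_singletons: "finite A \<Longrightarrow> x \<in># (\<Sum>j\<in>A. {#g j#}) \<longleftrightarrow> x \<in> g ` A"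
  by (induction A rule: finite_induct) auto

lemma (in pair_graph) connected_imp_ex_arc:
  assumes "Digraph_Component.connected (with_proj G)" "u \<in> pverts G" "v \<in> pverts G" "u \<noteq> v"
  obtains w where "(u, w) \<in> parcs G"
proof -
  \<comment> \<open>Connectedness refers to the symmetric closure, which has the same reachability
    because arcs come in opposite pairs.\<close>
  from assms have "u \<rightarrow>\<^sup>*\<^bsub>with_proj (mk_symmetric (with_proj G))\<^esub> v"
    by (auto simp: connected_def strongly_connected_def)
  then obtain p where p: "awalk u p v"
    by (auto simp: reachable_mk_symmetric_eq[OF sym_arcs] reachable_awalk)
  with \<open>u \<noteq> v\<close> obtain e q where "p = e # q"
    by (cases p) (auto simp: awalk_Nil_iff)
  with p that[of "snd e"] show thesis
    by (auto simp: awalk_Cons_iff)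
qed

lemma prod_over_adjacency_eigenvalues:
  fixes F :: "complex \<Rightarrow> 'c :: comm_monoid_mult" and l :: "nat \<Rightarrow> real"
  assumes "M = add_mset (complex_of_real (real r)) (\<Sum>j\<in>{2..p}. {# complex_of_real (l j) #})"
  shows "(\<Prod>x\<in>#M. F x) = F (of_nat r) * (\<Prod>j\<in>{2..p}. F (complex_of_real (l j)))"
  by (simp add: assms prod_mset_sum_singletons)

theorem theorem3p18:
  fixes G1 :: "'a pair_pre_digraph" and G2 :: "'b pair_pre_digraph"
    and r1 r2 p1 p2 :: nat
    and l1 l2 :: "nat \<Rightarrow> real"
    and vs1 :: "'a list" and vs2 :: "'b list"
    and vs :: "(('a + 'a set) + ('b + 'b set)) list"
  assumes reg1: "regular_graph r1 G1" and reg2: "regular_graph r2 G2"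
    and order1: "card (pverts G1) = p1" and order2: "card (pverts G2) = p2"
    and enum1: "distinct vs1" "set vs1 = pverts G1"
    and enum2: "distinct vs2" "set vs2 = pverts G2"
    and enum: "distinct vs" "set vs = pverts (subdivision_edge_join G1 G2)"
    and spec1: "eigenvalues_mset (adjacency_matrix G1 vs1) =
        add_mset (complex_of_real (real r1)) (\<Sum>j\<in>{2..p1}. {# complex_of_real (l1 j) #})"
    and spec2: "eigenvalues_mset (adjacency_matrix G2 vs2) =
        add_mset (complex_of_real (real r2)) (\<Sum>j\<in>{2..p2}. {# complex_of_real (l2 j) #})"
    and conn: "Digraph_Component.connected (with_proj (subdivision_edge_join G1 G2))"
  shows "\<forall>x::complex.
    real (count (eigenvalues_mset
             (distance_laplacian_matrix (subdivision_edge_join G1 G2) vs)) x) =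
      real (count (\<Sum>j\<in>{2..p1}. plus_minus_pair (centre1 p1 r1 p2 r2 (l1 j))
                                       (discriminant1 p1 r1 p2 r2 (l1 j))) x)
      + real (count (\<Sum>j\<in>{2..p2}. plus_minus_pair (centre2 p1 r1 p2 r2 (l2 j))
                                       (discriminant2 p1 r1 p2 r2 (l2 j))) x)
      + multiplicity_at
          (3 * real p1 + real p1 * real r1 + 2 * real p2 + 1/2 * real p2 * real r2 - 4)
          (1/2 * real p1 * real r1 - real p1) x
      + multiplicity_at
          (2 * real p1 + 1/2 * real p1 * real r1 + 3 * real p2 + real p2 * real r2 - 4)
          (1/2 * real p2 * real r2 - real p2) x
      + real (count (eigenvalues_mset (quotient_matrix p1 r1 p2 r2)) x)"
proof -
  interpret G1: pair_graph G1 using reg1 by (simp add: regular_graph_def)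
  interpret G2: pair_graph G2 using reg2 by (simp add: regular_graph_def)
  let ?J = "subdivision_edge_join G1 G2"
  interpret J: pair_graph ?J
    by (rule pair_graph_subdivision_edge_join) (rule G1.pair_graph_axioms G2.pair_graph_axioms)+

  \<comment> \<open>Non-empty graphs, positive degrees and eigenvalue bounds\<close>
  have len1: "length vs1 = p1" and len2: "length vs2 = p2"
    using enum1 enum2 order1 order2 distinct_card by metis+
  have size1: "size (eigenvalues_mset (adjacency_matrix G1 vs1)) = p1"
    using len1 by (intro size_eigenvalues_mset) (simp add: adjacency_matrix_def)
  have size2: "size (eigenvalues_mset (adjacency_matrix G2 vs2)) = p2"
    using len2 by (intro size_eigenvalues_mset) (simp add: adjacency_matrix_def)
  \<comment> \<open>The prescribed spectra contain \<open>r1\<close> and \<open>r2\<close>, so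
    neither graph is empty.\<close>
  have p1: "p1 > 0" and p2: "p2 > 0"
    using size1 size2 by (simp_all add: spec1 spec2)
  obtain u w where u: "u \<in> pverts G1" and w: "w \<in> pverts G2"
    using p1 p2 order1 order2 by (metis all_not_in_conv card.empty less_irrefl)
  then have uw: "Inl (Inl u) \<in> pverts ?J" "Inr (Inl w) \<in> pverts ?J"
    by (auto simp: pverts_subdivision_edge_join)
  \<comment> \<open>Degree 0 would isolate \<open>u\<close> in the join, although it is connected to
    \<open>w\<close> on the other side.\<close>
  have r1: "r1 > 0"
  proof -
    obtain y where "(Inl (Inl u), y) \<in> parcs ?J"
      using J.connected_imp_ex_arc[OF conn uw] by blast
    then have "{e \<in> undirected_edges G1. u \<in> e} \<noteq> {}"
      by (cases y rule: join_vertex_cases) auto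
    then show ?thesis
      using card_incident_edges[OF reg1 u] G1.finite_undirected_edges by (auto simp: card_gt_0_iff)
  qed
  have r2: "r2 > 0"
  proof -
    obtain y where "(Inr (Inl w), y) \<in> parcs ?J"
      using J.connected_imp_ex_arc[OF conn uw(2,1)] by blast
    then have "{e \<in> undirected_edges G2. w \<in> e} \<noteq> {}"
      by (cases y rule: join_vertex_cases) auto
    then show ?thesis
      using card_incident_edges[OF reg2 w] G2.finite_undirected_edges by (auto simp: card_gt_0_iff)
  qed
  have l1: "- real r1 \<le> l1 j" if "j \<in> {2..p1}" for j
    using that by (intro adjacency_eigenvalue_ge[OF reg1 enum1]) (simp add: spec1 in_sum_singletons)
  have l2: "- real r2 \<le> l2 j" if "j \<in> {2..p2}" for j
    using that by (intro adjacency_eigenvalue_ge[OF reg2 enum2]) (simp add: spec2 in_sum_singletons)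

  obtain es1 where es1: "distinct es1" "set es1 = undirected_edges G1"
    using finite_distinct_list[OF G1.finite_undirected_edges] by blast
  obtain es2 where es2: "distinct es2" "set es2 = undirected_edges G2"
    using finite_distinct_list[OF G2.finite_undirected_edges] by blast
  have m1: "real (length es1) = 1/2 * real p1 * real r1"
    using arg_cong[OF handshake[OF reg1], of real] distinct_card[OF es1(1)] es1(2) order1 by (simp add: mult.commute)
  have m2: "real (length es2) = 1/2 * real p2 * real r2"
    using arg_cong[OF handshake[OF reg2], of real] distinct_card[OF es2(1)] es2(2) order2 by (simp add: mult.commute)

  \<comment> \<open>The polynomial identity behind the spectrum\<close>
  define s1 where "s1 = edge_diagonal p1 r1 p2 r2"
  define s2 where "s2 = edge_diagonal p2 r2 p1 r1"
  define N1 where "N1 l = plus_minus_pair (centre1 p1 r1 p2 r2 l) (discriminant1 p1 r1 p2 r2 l)" for l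
  define N2 where "N2 l = plus_minus_pair (centre2 p1 r1 p2 r2 l) (discriminant2 p1 r1 p2 r2 l)" for l
  define lin :: "complex multiset \<Rightarrow> complex poly" where "lin M = (\<Prod>w\<in>#M. [:- w, 1:])" for M
  define E1 where "E1 = [:- complex_of_real s1, 1:]"
  define E2 where "E2 = [:- complex_of_real s2, 1:]"
  let ?L = "char_poly (map_mat complex_of_real (distance_laplacian_matrix ?J vs))"
  let ?Q = "char_poly (map_mat complex_of_real (quotient_matrix p1 r1 p2 r2))"
  let ?B1 = "\<Prod>j\<in>{2..p1}. lin (N1 (l1 j))"
  let ?B2 = "\<Prod>j\<in>{2..p2}. lin (N2 (l2 j))"
  have lin_nz [simp]: "lin M \<noteq> 0" for M
    by (auto simp: lin_def prod_mset_zero_iff)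
  have B_nz: "?B1 \<noteq> 0" "?B2 \<noteq> 0"
    by simp_all
  have E_nz [simp]: "E1 \<noteq> 0" "E2 \<noteq> 0"
    by (simp_all add: E1_def E2_def)

  \<comment> \<open>The powers of \<open>E1\<close> and \<open>E2\<close> come from the Schur
    complements, with the numbers of old and new vertices as exponents. The factors at
    \<open>r1\<close> and \<open>r2\<close> come from \<open>det Y\<close> on the left and from
    \<open>det X\<close> on the right; being nonzero polynomials, they cancel afterwards.\<close>
  have "E1 ^ p1 * E2 ^ p2 * ?L * (lin (N1 r1) * lin (N2 r2)) =
      E1 ^ length es1 * E2 ^ length es2 * ?B1 * ?B2 * ?Q * (lin (N1 r1) * lin (N2 r2))"
  proof (rule poly_eq_poly_eq_iff[THEN iffD1], rule ext)
    fix z :: complex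
    define y1 where "y1 = z - of_real s1"
    define y2 where "y2 = z - of_real s2"
    define a1 where "a1 = z - complex_of_real (vertex_diagonal p1 r1 p2 r2)"
    define a2 where "a2 = z - complex_of_real (vertex_diagonal p2 r2 p1 r1)"
    let ?X = "join_kernel (subdivision_kernel G1 a1 y1) (subdivision_kernel G2 a2 y2)"
    \<comment> \<open>An enumeration sorted by graph and then into old and new vertices, which makes
      the kernel block diagonal.\<close>
    let ?us1 = "map Inl vs1 @ map Inr es1" and ?us2 = "map Inl vs2 @ map Inr es2"
    let ?us = "map Inl ?us1 @ map Inr ?us2"
    have lin1: "poly (lin (N1 l)) z = y1 * (a1 - 2 * of_real l) - 4 * (of_real l + of_nat r1)"
      if "- real r1 \<le> l" for l
      using linear_factors_plus_minus_pair[OF that, of p1 p2 r2 z]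
      by (simp add: lin_def N1_def y1_def a1_def s1_def)
    have lin2: "poly (lin (N2 l)) z = y2 * (a2 - 2 * of_real l) - 4 * (of_real l + of_nat r2)"
      if "- real r2 \<le> l" for l
      using linear_factors_plus_minus_pair[OF that, of p2 p1 r1 z]
      by (simp add: lin_def N2_def centre2_eq discriminant2_eq y2_def a2_def s2_def)
    have us: "distinct ?us" "set ?us = pverts ?J"
      using enum1 enum2 es1 es2
      by (auto simp: distinct_map inj_on_def pverts_subdivision_edge_join Plus_def image_Un)
    have det1: "y1 ^ p1 * det (kernel_mat (subdivision_kernel G1 a1 y1) ?us1 ?us1) =
        y1 ^ length es1 * poly (lin (N1 r1)) z * poly ?B1 z"
      using det_subdivision_kernel[OF reg1 enum1 es1, of y1 a1]
      by (simp add: len1 prod_over_adjacency_eigenvalues[OF spec1] poly_prod lin1 l1 mult.assoc)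
    have det2: "y2 ^ p2 * det (kernel_mat (subdivision_kernel G2 a2 y2) ?us2 ?us2) =
        y2 ^ length es2 * poly (lin (N2 r2)) z * poly ?B2 z"
      using det_subdivision_kernel[OF reg2 enum2 es2, of y2 a2]
      by (simp add: len2 prod_over_adjacency_eigenvalues[OF spec2] poly_prod lin2 l2 mult.assoc)
    have "poly ?L z * (poly (lin (N1 r1)) z * poly (lin (N2 r2)) z) =
        det (kernel_mat ?X vs vs) * poly ?Q z"
      using poly_char_poly_distance_laplacian[OF reg1 reg2 r1 r2 order1[symmetric] p1 order2[symmetric] p2 enum, of z]
      by (simp add: lin1 lin2 a1_def a2_def y1_def y2_def s1_def s2_def algebra_simps)
    also have "det (kernel_mat ?X vs vs) = det (kernel_mat ?X ?us ?us)"
      using enum us by (intro det_kernel_mat_cong_set) auto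
    also have "\<dots> = det (kernel_mat (subdivision_kernel G1 a1 y1) ?us1 ?us1) *
        det (kernel_mat (subdivision_kernel G2 a2 y2) ?us2 ?us2)"
      by (rule det_join_kernel)
    finally have "y1 ^ p1 * y2 ^ p2 * poly ?L z * (poly (lin (N1 r1)) z * poly (lin (N2 r2)) z) =
        (y1 ^ p1 * det (kernel_mat (subdivision_kernel G1 a1 y1) ?us1 ?us1)) *
        (y2 ^ p2 * det (kernel_mat (subdivision_kernel G2 a2 y2) ?us2 ?us2)) * poly ?Q z"
      by (simp only: mult.assoc mult.left_commute)
    then show "poly (E1 ^ p1 * E2 ^ p2 * ?L * (lin (N1 r1) * lin (N2 r2))) z =
        poly (E1 ^ length es1 * E2 ^ length es2 * ?B1 * ?B2 * ?Q * (lin (N1 r1) * lin (N2 r2))) z"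
      unfolding det1 det2 by (simp add: E1_def E2_def y1_def y2_def mult_ac)
  qed
  then have eq: "E1 ^ p1 * E2 ^ p2 * ?L = E1 ^ length es1 * E2 ^ length es2 * ?B1 * ?B2 * ?Q"
    by simp

  \<comment> \<open>Roots with multiplicity\<close>
  have L_nz: "?L \<noteq> 0"
    by (rule monic_char_poly(2)[of _ "length vs"])
      (auto simp: distance_laplacian_matrix_def transmission_matrix_def distance_matrix_def intro!: carrier_matI)
  have Q_nz: "?Q \<noteq> 0"
    by (rule monic_char_poly(2)[of _ 4]) (auto simp: quotient_matrix_def mat_of_rows_list_def intro!: carrier_matI)
  have proots_lin: "proots (lin M) = M" for M
    by (simp add: lin_def proots_prod_linear)
  have proots_B1: "proots ?B1 = (\<Sum>j\<in>{2..p1}. N1 (l1 j))"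
    by (subst proots_prod) (simp_all add: proots_lin)
  have proots_B2: "proots ?B2 = (\<Sum>j\<in>{2..p2}. N2 (l2 j))"
    by (subst proots_prod) (simp_all add: proots_lin)
  have E_roots: "proots E1 = {#of_real s1#}" "proots E2 = {#of_real s2#}"
    by (simp_all add: E1_def E2_def)
  \<comment> \<open>The copies of \<open>s1\<close> and \<open>s2\<close> stay on both sides, since
    the difference of their numbers is negative for degree 1.\<close>
  have roots: "repeat_mset p1 {#of_real s1#} + repeat_mset p2 {#of_real s2#} + proots ?L =
      repeat_mset (length es1) {#of_real s1#} + repeat_mset (length es2) {#of_real s2#} +
      (\<Sum>j\<in>{2..p1}. N1 (l1 j)) + (\<Sum>j\<in>{2..p2}. N2 (l2 j)) + proots ?Q"
    using arg_cong[OF eq, of proots] B_nz L_nz Q_nz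
    by (simp add: proots_mult proots_power E_roots proots_B1 proots_B2)
  \<comment> \<open>Real-valued multiplicities permit the subtraction of \<open>p1\<close> and
    \<open>p2\<close>.\<close>
  have count: "real p1 * of_bool (x = of_real s1) + real p2 * of_bool (x = of_real s2) + real (count (proots ?L) x) =
      real (length es1) * of_bool (x = of_real s1) + real (length es2) * of_bool (x = of_real s2) +
      real (count (\<Sum>j\<in>{2..p1}. N1 (l1 j)) x) + real (count (\<Sum>j\<in>{2..p2}. N2 (l2 j)) x) +
      real (count (proots ?Q) x)" for x
    using arg_cong[OF roots, of "\<lambda>M. real (count M x)"]
    by (cases "x = of_real s1"; cases "x = of_real s2") (simp_all del: count_proots)
  show ?thesis
  proof
    fix x
    show "real (count (eigenvalues_mset (distance_laplacian_matrix ?J vs)) x) =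
      real (count (\<Sum>j\<in>{2..p1}. plus_minus_pair (centre1 p1 r1 p2 r2 (l1 j))
                                       (discriminant1 p1 r1 p2 r2 (l1 j))) x)
      + real (count (\<Sum>j\<in>{2..p2}. plus_minus_pair (centre2 p1 r1 p2 r2 (l2 j))
                                       (discriminant2 p1 r1 p2 r2 (l2 j))) x)
      + multiplicity_at
          (3 * real p1 + real p1 * real r1 + 2 * real p2 + 1/2 * real p2 * real r2 - 4)
          (1/2 * real p1 * real r1 - real p1) x
      + multiplicity_at
          (2 * real p1 + 1/2 * real p1 * real r1 + 3 * real p2 + real p2 * real r2 - 4)
          (1/2 * real p2 * real r2 - real p2) x
      + real (count (eigenvalues_mset (quotient_matrix p1 r1 p2 r2)) x)"
    proof -
      have s: "3 * real p1 + real p1 * real r1 + 2 * real p2 + 1/2 * real p2 * real r2 - 4 = s1"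
        "2 * real p1 + 1/2 * real p1 * real r1 + 3 * real p2 + real p2 * real r2 - 4 = s2"
        by (simp_all add: s1_def s2_def edge_diagonal_def)
      show ?thesis
        using count[of x]
        unfolding s eigenvalues_mset_def multiplicity_at_def N1_def N2_def m1 m2
        by (cases "x = of_real s1"; cases "x = of_real s2") (simp_all del: count_proots)
    qed
  qed
qed

end
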